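(* Let $U\subset\mathbb{R}^2$ be open. If the integral curves of a second order ODE $$\frac{d^2y}{dx^2}=\Lambda\Big(x,y,\frac{dy}{dx}\Big),\qquad (x,y)\in U,$$ are the (unparametrised) geodesics of a Levi-Civita connection on $U$, then $\Lambda$ is a polynomial of degree at most three in $dy/dx$, $$\Lambda=A_3(x,y)\Big(\frac{dy}{dx}\Big)^3+A_2(x,y)\Big(\frac{dy}{dx}\Big)^2+A_1(x,y)\frac{dy}{dx}+A_0(x,y),$$ and, assuming the $A_\alpha$ have continuous derivatives up to order five, $\det\mathcal M([\Gamma])=0$ on $U$, where $\mathcal M([\Gamma])$ is the $6\times6$ matrix with rows $\mathbf V, D_1\mathbf V,D_2\mathbf V,D_{(1}D_{1)}\mathbf V,D_{(1}D_{2)}\mathbf V,D_{(2}D_{2)}\mathbf V$ built from $A_0,\dots,A_3$ as in the context.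
   Context: Levi-Civita connections of metrics of any signature are allowed. Coordinates on $U$ are $(x^1,x^2)=(x,y)$; $\partial_1=\partial_x$, $\partial_2=\partial_y$. $[\Gamma]$ denotes the projective structure (class of torsion-free connections with the same unparametrised geodesics) whose geodesics are the integral curves of the cubic ODE. Liouville expressions: $L_1=\frac23\partial_x\partial_yA_1-\frac13\partial_x^2A_2-\partial_y^2A_0+A_0\partial_yA_2+A_2\partial_yA_0-A_3\partial_xA_0-2A_0\partial_xA_3-\frac23A_1\partial_yA_1+\frac13A_1\partial_xA_2$, $L_2=\frac23\partial_x\partial_yA_2-\frac13\partial_y^2A_1-\partial_x^2A_3-A_3\partial_xA_1-A_1\partial_xA_3+A_0\partial_yA_3+2A_3\partial_yA_0+\frac23A_2\partial_xA_2-\frac13A_2\partial_yA_1$. The row vector $\mathbf V=(V_1,\dots,V_6)$: $V_1=2\partial_yL_2+4A_2L_2+8A_3L_1$, $V_2=-2\partial_yL_1-2\partial_xL_2-\frac43A_1L_2+\frac43A_2L_1$, $V_3=2\partial_xL_1-8A_0L_2-4A_1L_1$, $V_4=-5L_2$, $V_5=-5L_1$, $V_6=0$. The $6\times6$ matrices $\mathbf\Omega_1,\mathbf\Omega_2$: $$\mathbf\Omega_1=\begin{pmatrix} -\frac23A_1&2A_0&0&0&0&0 \\ 0&0&0&-\frac12&0&0 \\ -2A_3&-\frac23A_2&\frac43A_1&0&1&0 \\ {a_{41}}&a_{42}&a_{43}&-\frac13A_1&-3A_0&0 \\ 0&0&0&0&0&-1 \\ {a_{61}}&a_{62}&a_{63}&a_{64}&a_{65}&-\frac13A_1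 \end{pmatrix},\quad \mathbf\Omega_2=\begin{pmatrix} -\frac43A_2&\frac23A_1&2A_0&1&0&0 \\ 0&0&0&0&-\frac12&0 \\ 0&-2A_3&\frac23A_2&0&0&0 \\ 0&0&0&0&0&-1 \\ {b_{51}}&b_{52}&b_{53}&3A_3&\frac13A_2&0 \\ {b_{61}}&b_{62}&b_{63}&b_{64}&b_{65}&\frac13A_2 \end{pmatrix}$$ with $a_{41}=-\frac43\partial_xA_2+4A_0A_3+\frac23\partial_yA_1$; $a_{42}=-2\partial_yA_0+\frac23\partial_xA_1+4A_2A_0-\frac49A_1^2$; $a_{43}=2\partial_xA_0-4A_0A_1$; $a_{61}=-\frac43\partial_x\partial_yA_2-\frac{20}3A_0A_2A_3+\frac23\partial_y^2A_1+4A_3\partial_yA_0-2A_0\partial_yA_3-\frac{16}9A_2\partial_xA_2+\frac89A_2\partial_yA_1$; $a_{62}=\frac23\partial_x\partial_yA_1-\frac43A_1\partial_yA_1+2A_0\partial_yA_2-2\partial_y^2A_0+4A_2\partial_yA_0+4A_3\partial_xA_0+6A_0\partial_xA_3+\frac89A_1\partial_xA_2+\frac43A_0A_1A_3-\frac43A_0A_2^2$; $a_{63}=2\partial_x\partial_yA_0+\frac23A_0\partial_xA_2-\frac43A_2\partial_xA_0-4A_1\partial_yA_0-\frac43A_0\partial_yA_1+\frac83A_0A_1A_2+4A_3A_0^2$; $a_{64}=\frac43\partial_xA_2-\partial_yA_1+5A_0A_3$; $a_{65}=\frac13\partial_xA_1-4\partial_yA_0+3A_2A_0-\frac29A_1^2$;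 $b_{51}=-2\partial_yA_3-4A_3A_2$; $b_{52}=2\partial_xA_3-\frac23\partial_yA_2+4A_1A_3-\frac49A_2^2$; $b_{53}=\frac43\partial_yA_1-\frac23\partial_xA_2+4A_0A_3$; $b_{61}=-2\partial_x\partial_yA_3-4A_2\partial_xA_3-\frac43A_3\partial_xA_2+\frac23A_3\partial_yA_1-\frac43A_1\partial_yA_3-4A_0A_3^2-\frac83A_1A_2A_3$; $b_{62}=2\partial_x^2A_3-\frac43A_2\partial_xA_2-\frac43A_0A_2A_3-\frac23\partial_x\partial_yA_2+4A_1\partial_xA_3+4A_0\partial_yA_3+6A_3\partial_yA_0+\frac43A_3A_1^2+2A_3\partial_xA_1+\frac89A_2\partial_yA_1$; $b_{63}=-\frac23\partial_x^2A_2+\frac89A_1\partial_xA_2+4A_0\partial_xA_3-2A_3\partial_xA_0-\frac{16}9A_1\partial_yA_1+\frac43\partial_x\partial_yA_1+\frac{20}3A_0A_1A_3$; $b_{64}=4\partial_xA_3-\frac13\partial_yA_2+3A_1A_3-\frac29A_2^2$; $b_{65}=\partial_xA_2-\frac43\partial_yA_1+5A_0A_3$. For a row-vector valued function $\mathbf W:U\to\mathbb{R}^6$ set $D_a\mathbf W=\partial_a\mathbf W-\mathbf W\,\mathbf\Omega_a$ ($a=1,2$), iterated: $D_aD_b\mathbf V=\partial_a(D_b\mathbf V)-(D_b\mathbf V)\mathbf\Omega_a$. Round brackets around indices denote symmetrisation. *)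

theory Defs
  imports "HOL-Analysis.Analysis"
begin

text \<open>A point of the plane is \<open>p :: real^2\<close> with coordinates \<open>x = p $ 1\<close> and \<open>y = p $ 2\<close>.\<close>

definition pd :: "2 \<Rightarrow> (real^2 \<Rightarrow> 'a::real_normed_vector) \<Rightarrow> real^2 \<Rightarrow> 'a"  (\<open>\<partial>\<close>)
  where "\<partial> a f p = vector_derivative (\<lambda>t. f (p + t *\<^sub>R axis a 1)) (at 0)"

abbreviation pd_x :: "(real^2 \<Rightarrow> 'a::real_normed_vector) \<Rightarrow> real^2 \<Rightarrow> 'a"  (\<open>\<partial>\<^sub>x\<close>)
  where "\<partial>\<^sub>x \<equiv> \<partial> 1"

abbreviation pd_y :: "(real^2 \<Rightarrow> 'a::real_normed_vector) \<Rightarrow> real^2 \<Rightarrow> 'a"  (\<open>\<partial>\<^sub>y\<close>)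
  where "\<partial>\<^sub>y \<equiv> \<partial> 2"

text \<open>\<open>Ck_on k U f\<close> (for open \<open>U\<close>): \<open>f\<close> has continuous partial derivatives up to order \<open>k\<close> on \<open>U\<close>.\<close>

fun Ck_on :: "nat \<Rightarrow> (real^2) set \<Rightarrow> (real^2 \<Rightarrow> real) \<Rightarrow> bool"
  where
    "Ck_on 0 U f \<longleftrightarrow> continuous_on U f"
  | "Ck_on (Suc k) U f \<longleftrightarrow> f differentiable_on U \<and> (\<forall>a. Ck_on k U (\<partial> a f))"


section \<open>Metrics, connections and geodesics\<close>

text \<open>
  Pseudo-Riemannian metrics of any signature. Class \<open>C\<^sup>2\<close> makes the Levi-Civita connection
  continuously differentiable, so that there is exactly one unparametrised geodesic through each
  point in each direction.
\<close>

definition metric_on :: "(real^2) set \<Rightarrow> (real^2 \<Rightarrow> real^2^2) \<Rightarrow> bool"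
  where "metric_on U g \<longleftrightarrow>
    (\<forall>p\<in>U. transpose (g p) = g p \<and> det (g p) \<noteq> 0) \<and>
    (\<forall>a b. Ck_on 2 U (\<lambda>p. g p $ a $ b))"

text \<open>The connection coefficient \<open>\<Gamma>\<^sup>c\<^sub>a\<^sub>b\<close> at \<open>p\<close> is \<open>\<Gamma> c a b p\<close>.\<close>

type_synonym connection = "2 \<Rightarrow> 2 \<Rightarrow> 2 \<Rightarrow> real^2 \<Rightarrow> real"

definition levi_civita_on :: "(real^2) set \<Rightarrow> (real^2 \<Rightarrow> real^2^2) \<Rightarrow> connection \<Rightarrow> bool"
  where "levi_civita_on U g \<Gamma> \<longleftrightarrow>
    (\<forall>p\<in>U. \<forall>a b c. \<Gamma> c a b p = \<Gamma> c b a p) \<and>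
    (\<forall>p\<in>U. \<forall>a b c. \<partial> a (\<lambda>q. g q $ b $ c) p
        - (\<Sum>d\<in>UNIV. \<Gamma> d a b p * g p $ d $ c) - (\<Sum>d\<in>UNIV. \<Gamma> d a c p * g p $ b $ d) = 0)"

text \<open>
  A regular curve is an unparametrised geodesic if its acceleration is proportional to its
  velocity, with a factor \<open>v\<close> depending on the parameter; equivalently, it can be
  reparametrised to satisfy the geodesic equation with \<open>v = 0\<close>.
\<close>

definition unparametrised_geodesic ::
    "(real^2) set \<Rightarrow> connection \<Rightarrow> real set \<Rightarrow> (real \<Rightarrow> real^2) \<Rightarrow> bool"
  where "unparametrised_geodesic U \<Gamma> I \<gamma> \<longleftrightarrow>
    (\<exists>\<gamma>' \<gamma>'' v. \<forall>t\<in>I. \<gamma> t \<in> U \<and> \<gamma>' t \<noteq> 0 \<and>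
       (\<gamma> has_vector_derivative \<gamma>' t) (at t) \<and> (\<gamma>' has_vector_derivative \<gamma>'' t) (at t) \<and>
       (\<forall>c. \<gamma>'' t $ c + (\<Sum>a\<in>UNIV. \<Sum>b\<in>UNIV. \<Gamma> c a b (\<gamma> t) * \<gamma>' t $ a * \<gamma>' t $ b)
            = v t * \<gamma>' t $ c))"

definition ode_solution ::
    "(real^2) set \<Rightarrow> (real^2 \<Rightarrow> real \<Rightarrow> real) \<Rightarrow> real set \<Rightarrow> (real \<Rightarrow> real) \<Rightarrow> bool"
  where "ode_solution U \<Lambda> I y \<longleftrightarrow>
    (\<exists>y'. \<forall>x\<in>I. vector [x, y x] \<in> U \<and>
       (y has_real_derivative y' x) (at x) \<and>
       (y' has_real_derivative \<Lambda> (vector [x, y x]) (y' x)) (at x))"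

text \<open>
  The integral curves \<open>x \<mapsto> (x, y x)\<close> of the ODE are exactly the unparametrised geodesics of
  \<open>\<Gamma>\<close>. Integral curves are graphs over the \<open>x\<close>-axis, so only geodesics that are nowhere
  tangent to \<open>\<partial>\<^sub>y\<close> can occur; these can always be parametrised by \<open>x\<close>, and being an
  unparametrised geodesic does not depend on the parametrisation.
\<close>

definition integral_curves_are_geodesics ::
    "(real^2) set \<Rightarrow> (real^2 \<Rightarrow> real \<Rightarrow> real) \<Rightarrow> connection \<Rightarrow> bool"
  where "integral_curves_are_geodesics U \<Lambda> \<Gamma> \<longleftrightarrow>
    (\<forall>I y. open I \<and> is_interval I \<longrightarrow>
       (ode_solution U \<Lambda> I y \<longleftrightarrow> unparametrised_geodesic U \<Gamma> I (\<lambda>x. vector [x, y x])))"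


section \<open>The matrix of a cubic second order ODE\<close>

locale cubic_ode =
  fixes A0 A1 A2 A3 :: "real^2 \<Rightarrow> real"
begin

text \<open>The Liouville expressions.\<close>

definition L1 :: "real^2 \<Rightarrow> real"
  where "L1 p =
    2/3 * \<partial>\<^sub>x (\<partial>\<^sub>y A1) p - 1/3 * \<partial>\<^sub>x (\<partial>\<^sub>x A2) p - \<partial>\<^sub>y (\<partial>\<^sub>y A0) p
    + A0 p * \<partial>\<^sub>y A2 p + A2 p * \<partial>\<^sub>y A0 p - A3 p * \<partial>\<^sub>x A0 p - 2 * A0 p * \<partial>\<^sub>x A3 p
    - 2/3 * A1 p * \<partial>\<^sub>y A1 p + 1/3 * A1 p * \<partial>\<^sub>x A2 p"

definition L2 :: "real^2 \<Rightarrow> real"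
  where "L2 p =
    2/3 * \<partial>\<^sub>x (\<partial>\<^sub>y A2) p - 1/3 * \<partial>\<^sub>y (\<partial>\<^sub>y A1) p - \<partial>\<^sub>x (\<partial>\<^sub>x A3) p
    - A3 p * \<partial>\<^sub>x A1 p - A1 p * \<partial>\<^sub>x A3 p + A0 p * \<partial>\<^sub>y A3 p + 2 * A3 p * \<partial>\<^sub>y A0 p
    + 2/3 * A2 p * \<partial>\<^sub>x A2 p - 1/3 * A2 p * \<partial>\<^sub>y A1 p"

definition V :: "real^2 \<Rightarrow> real^6"
  where "V p = vector
    [2 * \<partial>\<^sub>y L2 p + 4 * A2 p * L2 p + 8 * A3 p * L1 p,
     - 2 * \<partial>\<^sub>y L1 p - 2 * \<partial>\<^sub>x L2 p - 4/3 * A1 p * L2 p + 4/3 * A2 p * L1 p,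
     2 * \<partial>\<^sub>x L1 p - 8 * A0 p * L2 p - 4 * A1 p * L1 p,
     - 5 * L2 p,
     - 5 * L1 p,
     0]"

definition a41 :: "real^2 \<Rightarrow> real"
  where "a41 p = - 4/3 * \<partial>\<^sub>x A2 p + 4 * A0 p * A3 p + 2/3 * \<partial>\<^sub>y A1 p"

definition a42 :: "real^2 \<Rightarrow> real"
  where "a42 p = - 2 * \<partial>\<^sub>y A0 p + 2/3 * \<partial>\<^sub>x A1 p + 4 * A2 p * A0 p - 4/9 * (A1 p)^2"

definition a43 :: "real^2 \<Rightarrow> real"
  where "a43 p = 2 * \<partial>\<^sub>x A0 p - 4 * A0 p * A1 p"

definition a61 :: "real^2 \<Rightarrow> real"
  where "a61 p =
    - 4/3 * \<partial>\<^sub>x (\<partial>\<^sub>y A2) p - 20/3 * A0 p * A2 p * A3 p + 2/3 * \<partial>\<^sub>y (\<partial>\<^sub>y A1) p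
    + 4 * A3 p * \<partial>\<^sub>y A0 p - 2 * A0 p * \<partial>\<^sub>y A3 p - 16/9 * A2 p * \<partial>\<^sub>x A2 p
    + 8/9 * A2 p * \<partial>\<^sub>y A1 p"

definition a62 :: "real^2 \<Rightarrow> real"
  where "a62 p =
    2/3 * \<partial>\<^sub>x (\<partial>\<^sub>y A1) p - 4/3 * A1 p * \<partial>\<^sub>y A1 p + 2 * A0 p * \<partial>\<^sub>y A2 p
    - 2 * \<partial>\<^sub>y (\<partial>\<^sub>y A0) p + 4 * A2 p * \<partial>\<^sub>y A0 p + 4 * A3 p * \<partial>\<^sub>x A0 p
    + 6 * A0 p * \<partial>\<^sub>x A3 p + 8/9 * A1 p * \<partial>\<^sub>x A2 p + 4/3 * A0 p * A1 p * A3 p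
    - 4/3 * A0 p * (A2 p)^2"

definition a63 :: "real^2 \<Rightarrow> real"
  where "a63 p =
    2 * \<partial>\<^sub>x (\<partial>\<^sub>y A0) p + 2/3 * A0 p * \<partial>\<^sub>x A2 p - 4/3 * A2 p * \<partial>\<^sub>x A0 p
    - 4 * A1 p * \<partial>\<^sub>y A0 p - 4/3 * A0 p * \<partial>\<^sub>y A1 p + 8/3 * A0 p * A1 p * A2 p
    + 4 * A3 p * (A0 p)^2"

definition a64 :: "real^2 \<Rightarrow> real"
  where "a64 p = 4/3 * \<partial>\<^sub>x A2 p - \<partial>\<^sub>y A1 p + 5 * A0 p * A3 p"

definition a65 :: "real^2 \<Rightarrow> real"
  where "a65 p = 1/3 * \<partial>\<^sub>x A1 p - 4 * \<partial>\<^sub>y A0 p + 3 * A2 p * A0 p - 2/9 * (A1 p)^2"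

definition b51 :: "real^2 \<Rightarrow> real"
  where "b51 p = - 2 * \<partial>\<^sub>y A3 p - 4 * A3 p * A2 p"

definition b52 :: "real^2 \<Rightarrow> real"
  where "b52 p = 2 * \<partial>\<^sub>x A3 p - 2/3 * \<partial>\<^sub>y A2 p + 4 * A1 p * A3 p - 4/9 * (A2 p)^2"

definition b53 :: "real^2 \<Rightarrow> real"
  where "b53 p = 4/3 * \<partial>\<^sub>y A1 p - 2/3 * \<partial>\<^sub>x A2 p + 4 * A0 p * A3 p"

definition b61 :: "real^2 \<Rightarrow> real"
  where "b61 p =
    - 2 * \<partial>\<^sub>x (\<partial>\<^sub>y A3) p - 4 * A2 p * \<partial>\<^sub>x A3 p - 4/3 * A3 p * \<partial>\<^sub>x A2 p
    + 2/3 * A3 p * \<partial>\<^sub>y A1 p - 4/3 * A1 p * \<partial>\<^sub>y A3 p - 4 * A0 p * (A3 p)^2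
    - 8/3 * A1 p * A2 p * A3 p"

definition b62 :: "real^2 \<Rightarrow> real"
  where "b62 p =
    2 * \<partial>\<^sub>x (\<partial>\<^sub>x A3) p - 4/3 * A2 p * \<partial>\<^sub>x A2 p - 4/3 * A0 p * A2 p * A3 p
    - 2/3 * \<partial>\<^sub>x (\<partial>\<^sub>y A2) p + 4 * A1 p * \<partial>\<^sub>x A3 p + 4 * A0 p * \<partial>\<^sub>y A3 p
    + 6 * A3 p * \<partial>\<^sub>y A0 p + 4/3 * A3 p * (A1 p)^2 + 2 * A3 p * \<partial>\<^sub>x A1 p
    + 8/9 * A2 p * \<partial>\<^sub>y A1 p"

definition b63 :: "real^2 \<Rightarrow> real"
  where "b63 p =
    - 2/3 * \<partial>\<^sub>x (\<partial>\<^sub>x A2) p + 8/9 * A1 p * \<partial>\<^sub>x A2 p + 4 * A0 p * \<partial>\<^sub>x A3 p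
    - 2 * A3 p * \<partial>\<^sub>x A0 p - 16/9 * A1 p * \<partial>\<^sub>y A1 p + 4/3 * \<partial>\<^sub>x (\<partial>\<^sub>y A1) p
    + 20/3 * A0 p * A1 p * A3 p"

definition b64 :: "real^2 \<Rightarrow> real"
  where "b64 p = 4 * \<partial>\<^sub>x A3 p - 1/3 * \<partial>\<^sub>y A2 p + 3 * A1 p * A3 p - 2/9 * (A2 p)^2"

definition b65 :: "real^2 \<Rightarrow> real"
  where "b65 p = \<partial>\<^sub>x A2 p - 4/3 * \<partial>\<^sub>y A1 p + 5 * A0 p * A3 p"

definition Omega1 :: "real^2 \<Rightarrow> real^6^6"
  where "Omega1 p = vector
    [vector [- 2/3 * A1 p, 2 * A0 p, 0, 0, 0, 0],
     vector [0, 0, 0, - 1/2, 0, 0],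
     vector [- 2 * A3 p, - 2/3 * A2 p, 4/3 * A1 p, 0, 1, 0],
     vector [a41 p, a42 p, a43 p, - 1/3 * A1 p, - 3 * A0 p, 0],
     vector [0, 0, 0, 0, 0, - 1],
     vector [a61 p, a62 p, a63 p, a64 p, a65 p, - 1/3 * A1 p]]"

definition Omega2 :: "real^2 \<Rightarrow> real^6^6"
  where "Omega2 p = vector
    [vector [- 4/3 * A2 p, 2/3 * A1 p, 2 * A0 p, 1, 0, 0],
     vector [0, 0, 0, 0, - 1/2, 0],
     vector [0, - 2 * A3 p, 2/3 * A2 p, 0, 0, 0],
     vector [0, 0, 0, 0, 0, - 1],
     vector [b51 p, b52 p, b53 p, 3 * A3 p, 1/3 * A2 p, 0],
     vector [b61 p, b62 p, b63 p, b64 p, b65 p, 1/3 * A2 p]]"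

definition Omega :: "2 \<Rightarrow> real^2 \<Rightarrow> real^6^6"
  where "Omega a = (if a = 1 then Omega1 else Omega2)"

definition D :: "2 \<Rightarrow> (real^2 \<Rightarrow> real^6) \<Rightarrow> real^2 \<Rightarrow> real^6"
  where "D a W p = \<partial> a W p - W p v* Omega a p"

definition symD :: "2 \<Rightarrow> 2 \<Rightarrow> (real^2 \<Rightarrow> real^6) \<Rightarrow> real^2 \<Rightarrow> real^6"
  where "symD a b W p = (1/2) *\<^sub>R (D a (D b W) p + D b (D a W) p)"

definition M :: "real^2 \<Rightarrow> real^6^6"
  where "M p = vector [V p, D 1 V p, D 2 V p, symD 1 1 V p, symD 1 2 V p, symD 2 2 V p]"

end

end

(*
The geodesic equation, written as an equation for y(x), is y'' = cubic in y' with coefficients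
built from the Christoffel symbols. Since a geodesic starts at every point in every direction
(Picard-Lindelof), Lambda is that cubic.

For a metric E dx^2 + 2F dx dy + G dy^2 with determinant d, the functions (E, F, G) |d|^(-2/3)
solve a linear overdetermined first order system with coefficients A0, ..., A3 (Liouville).
Adjoining three derivatives closes the system to d_a Psi = - Omega_a Psi for a = 1, 2. Equality
of the mixed derivatives of Psi gives V Psi = 0, and differentiating this relation twice along
the connection shows that Psi, which vanishes nowhere, is in the kernel of M.
*)
theory Submission
  imports Defs
begin

section \<open>Partial derivatives and functions of class \<open>C\<^sup>k\<close>\<close>

text \<open>Liouville's system is the Killing type equation \<nabla>_(a z_bc) = 0 for the trace-free
  connection of the projective class, whose symbols are \<Pi>^1_11 = A1/3, \<Pi>^2_11 = - A0,
  \<Pi>^1_12 = A2/3, \<Pi>^1_22 = A3, \<Pi>^2_12 = - A1/3, \<Pi>^2_22 = - A2/3. This is why the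
  coefficients of the ODE alone enter it. For a parallel metric, the power -2/3 of |d| is the one
  for which the trace of the Levi-Civita symbols drops out after symmetrisation. The obstacle is
  regularity. A C^2 metric makes z of class C^2, its first derivatives C^1 and the last adjoined
  variable merely continuous, whereas the relation V Psi = 0 compares second derivatives of that
  variable. They are produced by a form of Schwarz's theorem that yields the second mixed derivative
  instead of assuming it, applied along the prolongation. The A's lose two derivatives in
  \<open>L1\<close> and \<open>L2\<close>, one more in \<open>V\<close> and two more in the last
  rows of the matrix, five in all.\<close>

definition has_pd :: "2 \<Rightarrow> (real^2 \<Rightarrow> 'a::real_normed_vector) \<Rightarrow> 'a \<Rightarrow> real^2 \<Rightarrow> bool"
  where "has_pd a f D p \<longleftrightarrow> ((\<lambda>t. f (p + t *\<^sub>R axis a 1)) has_vector_derivative D) (at 0)"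

lemma pd_eq: "has_pd a f D p \<Longrightarrow> \<partial> a f p = D"
  by (simp add: has_pd_def pd_def vector_derivative_at)

lemma has_pd_line:
  assumes "has_pd a f D (p + s *\<^sub>R axis a 1)"
  shows "((\<lambda>t. f (p + t *\<^sub>R axis a 1)) has_vector_derivative D) (at s)"
proof -
  have "((\<lambda>t. f (p + s *\<^sub>R axis a 1 + t *\<^sub>R axis a 1)) \<circ> (\<lambda>t. t - s) has_vector_derivative 1 *\<^sub>R D) (at s)"
    by (rule vector_diff_chain_at)
       (use assms in \<open>auto intro!: derivative_eq_intros simp: has_pd_def\<close>)
  then show ?thesis
    by (simp add: o_def algebra_simps)
qed

lemma has_pd_cong:
  assumes "has_pd a f D p" "open U" "p \<in> U" "\<And>q. q \<in> U \<Longrightarrow> f q = g q"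
  shows "has_pd a g D p"
proof -
  have "open ((\<lambda>t::real. p + t *\<^sub>R axis a 1) -` U)"
    by (intro continuous_open_vimage assms continuous_intros)
  from has_vector_derivative_transform_within_open[OF assms(1)[unfolded has_pd_def] this] assms(3,4)
  show ?thesis
    by (simp add: has_pd_def)
qed

lemma pd_cong:
  assumes "open U" "p \<in> U" "\<And>q. q \<in> U \<Longrightarrow> f q = g q"
  shows "\<partial> a f p = \<partial> a g p"
proof -
  have "open ((\<lambda>t::real. p + t *\<^sub>R axis a 1) -` U)"
    by (intro continuous_open_vimage assms continuous_intros)
  then have "\<forall>\<^sub>F t in nhds 0. t \<in> ((\<lambda>t::real. p + t *\<^sub>R axis a 1) -` U)"
    using assms(2) by (intro eventually_nhds_in_open) auto
  then show ?thesis
    unfolding pd_def using assms(3)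
    by (intro vector_derivative_cong_eq) (auto elim!: eventually_mono)
qed

lemma has_pd_has_derivative:
  assumes "(f has_derivative f') (at p)"
  shows "has_pd a f (f' (axis a 1)) p"
  unfolding has_pd_def has_vector_derivative_def
proof -
  have "((\<lambda>t::real. p + t *\<^sub>R axis a 1) has_derivative (\<lambda>t. t *\<^sub>R axis a 1)) (at 0)"
    by (auto intro!: derivative_eq_intros)
  moreover have "(f has_derivative f') (at (p + 0 *\<^sub>R axis a 1))"
    using assms by simp
  ultimately have "(f \<circ> (\<lambda>t::real. p + t *\<^sub>R axis a 1) has_derivative f' \<circ> (\<lambda>t. t *\<^sub>R axis a 1)) (at 0)"
    by (rule diff_chain_at)
  moreover have "linear f'"
    using assms by (rule has_derivative_linear)
  ultimately show "((\<lambda>t. f (p + t *\<^sub>R axis a 1)) has_derivative (\<lambda>x. x *\<^sub>R f' (axis a 1))) (at 0)"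
    by (simp add: o_def linear_scale)
qed

lemma has_pd_differentiable:
  assumes "f differentiable (at p)"
  shows "has_pd a f (\<partial> a f p) p"
  using assms has_pd_has_derivative pd_eq unfolding differentiable_def by metis

lemma has_derivative_pd:
  fixes f :: "real^2 \<Rightarrow> real"
  assumes "f differentiable (at p)"
  shows "(f has_derivative (\<lambda>v. \<partial> 1 f p * v $ 1 + \<partial> 2 f p * v $ 2)) (at p)"
proof -
  obtain f' where f': "(f has_derivative f') (at p)"
    using assms by (auto simp: differentiable_def)
  have lin: "linear f'"
    using f' by (rule has_derivative_linear)
  have "f' v = \<partial> 1 f p * v $ 1 + \<partial> 2 f p * v $ 2" for v
  proof -
    have "v = v $ 1 *\<^sub>R axis 1 1 + v $ 2 *\<^sub>R axis 2 1"
      by (simp add: vec_eq_iff forall_2 axis_def)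
    from arg_cong[OF this, of f'] have "f' v = v $ 1 *\<^sub>R f' (axis 1 1) + v $ 2 *\<^sub>R f' (axis 2 1)"
      unfolding linear_add[OF lin] linear_scale[OF lin] .
    then show ?thesis
      using pd_eq[OF has_pd_has_derivative[OF f']] by (simp add: mult.commute)
  qed
  then have "f' = (\<lambda>v. \<partial> 1 f p * v $ 1 + \<partial> 2 f p * v $ 2)"
    by (rule ext)
  then show ?thesis
    using f' by simp
qed

section \<open>Differentiation rules for partial derivatives\<close>

named_theorems has_pd_intros

lemma has_pd_const [has_pd_intros]: "0 = D \<Longrightarrow> has_pd a (\<lambda>_. c) D p"
  by (auto simp: has_pd_def)

text \<open>The value enters through an equation, so that the rule unifies with a derivative stated
  in any shape and leaves the arithmetic as a goal.\<close>

lemma has_pd_add [has_pd_intros]: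
  "has_pd a f D p \<Longrightarrow> has_pd a g E p \<Longrightarrow> D + E = F \<Longrightarrow> has_pd a (\<lambda>q. f q + g q) F p"
  by (auto simp: has_pd_def intro!: derivative_eq_intros)

lemma has_pd_minus [has_pd_intros]:
  "has_pd a f D p \<Longrightarrow> - D = F \<Longrightarrow> has_pd a (\<lambda>q. - f q) F p"
  by (auto simp: has_pd_def intro!: derivative_eq_intros)

lemma has_pd_diff [has_pd_intros]:
  "has_pd a f D p \<Longrightarrow> has_pd a g E p \<Longrightarrow> D - E = F \<Longrightarrow> has_pd a (\<lambda>q. f q - g q) F p"
  by (auto simp: has_pd_def intro!: derivative_eq_intros)

lemma has_pd_mult [has_pd_intros]:
  fixes f g :: "real^2 \<Rightarrow> real"
  shows "has_pd a f D p \<Longrightarrow> has_pd a g E p \<Longrightarrow> D * g p + f p * E = F \<Longrightarrow> has_pd a (\<lambda>q. f q * g q) F p"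
  unfolding has_pd_def has_real_derivative_iff_has_vector_derivative[symmetric]
  by (auto intro!: derivative_eq_intros)

lemma has_pd_power [has_pd_intros]:
  fixes f :: "real^2 \<Rightarrow> real"
  shows "has_pd a f D p \<Longrightarrow> of_nat n * f p ^ (n - 1) * D = F \<Longrightarrow> has_pd a (\<lambda>q. f q ^ n) F p"
  unfolding has_pd_def has_real_derivative_iff_has_vector_derivative[symmetric]
  by (auto intro!: derivative_eq_intros)

lemma has_pd_inverse:
  fixes f :: "real^2 \<Rightarrow> real"
  shows "has_pd a f D p \<Longrightarrow> f p \<noteq> 0 \<Longrightarrow> has_pd a (\<lambda>q. inverse (f q)) (- (D * inverse (f p) * inverse (f p))) p"
  unfolding has_pd_def has_real_derivative_iff_has_vector_derivative[symmetric]
  by (auto intro!: derivative_eq_intros simp: field_simps power2_eq_square)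

text \<open>The value keeps the exponent \<open>r\<close> and puts the shift into a factor
  \<open>inverse (f p)\<close>. In the induction for \<open>Ck_on_powr\<close> the same power then
  recurs and the induction hypothesis covers it.\<close>

lemma has_pd_powr:
  fixes f :: "real^2 \<Rightarrow> real"
  assumes "has_pd a f D p" "f p > 0"
  shows "has_pd a (\<lambda>q. f q powr r) (r * f p powr r * D * inverse (f p)) p"
proof -
  have "((\<lambda>t. f (p + t *\<^sub>R axis a 1) powr r) has_real_derivative
      (r * f (p + 0 *\<^sub>R axis a 1) powr (r - of_nat 1) * D)) (at 0)"
    using assms unfolding has_pd_def has_real_derivative_iff_has_vector_derivative[symmetric]
    by (intro DERIV_fun_powr) auto
  then show ?thesis
    using assms unfolding has_pd_def has_real_derivative_iff_has_vector_derivative[symmetric]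
    by (simp add: powr_diff field_simps)
qed

lemma has_pd_vec:
  fixes f :: "real^2 \<Rightarrow> real^'n"
  assumes "\<And>i. has_pd a (\<lambda>q. f q $ i) (D $ i) p"
  shows "has_pd a f D p"
  using assms unfolding has_pd_def has_vector_derivative_def
  by (subst has_derivative_componentwise_within) (auto simp: Basis_vec_def inner_axis)

lemma has_pd_inner:
  fixes f g :: "real^2 \<Rightarrow> 'a::real_inner"
  assumes "has_pd a f D p" "has_pd a g E p"
  shows "has_pd a (\<lambda>q. f q \<bullet> g q) (D \<bullet> g p + f p \<bullet> E) p"
  using assms unfolding has_pd_def has_vector_derivative_def
  by (auto intro!: derivative_eq_intros simp: inner_simps algebra_simps)

section \<open>Existence and symmetry of mixed derivatives\<close>

text \<open>Schwarz's theorem in Peano's form: existence of the second mixed derivative is part of the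
  conclusion.\<close>

lemma has_pd_mixed:
  fixes f :: "real^2 \<Rightarrow> real"
  assumes "open U" "p \<in> U"
    and fa: "\<And>q. q \<in> U \<Longrightarrow> has_pd a f (fa q) q"
    and fb: "\<And>q. q \<in> U \<Longrightarrow> has_pd b f (fb q) q"
    and fba: "\<And>q. q \<in> U \<Longrightarrow> has_pd b fa (fba q) q"
    and cont: "continuous_on U fba"
  shows "has_pd a fb (fba p) p"
proof -
  let ?a = "axis a 1 :: real^2" and ?b = "axis b 1 :: real^2" and ?c = "fba p"
  have "\<exists>d>0. \<forall>h. 0 < \<bar>h\<bar> \<and> \<bar>h\<bar> < d \<longrightarrow> \<bar>fb (p + h *\<^sub>R ?a) - fb p - h * ?c\<bar> \<le> e * \<bar>h\<bar>" if "e > 0" for e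
  proof -
    have "continuous (at p) fba"
      using cont assms(1,2) by (simp add: continuous_on_eq_continuous_at)
    then obtain d1 where d1: "d1 > 0" "\<And>q. dist q p < d1 \<Longrightarrow> dist (fba q) ?c < e"
      using \<open>e > 0\<close> unfolding continuous_at by (metis dist_commute continuous_at_eps_delta \<open>continuous (at p) fba\<close>)
    obtain d2 where d2: "d2 > 0" "ball p d2 \<subseteq> U"
      using assms(1,2) open_contains_ball by blast
    \<comment> \<open>The offset has norm at most |s| + |t| < 2 * d, so the whole square of half
      side d lies in both balls.\<close>
    define d where "d = min d1 d2 / 2"
    have "d > 0"
      using d1 d2 by (simp add: d_def)
    let ?S = "{-d<..<d}"
    have near: "p + s *\<^sub>R ?a + t *\<^sub>R ?b \<in> U" "\<bar>fba (p + s *\<^sub>R ?a + t *\<^sub>R ?b) - ?c\<bar> \<le> e"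
      if "s \<in> ?S" "t \<in> ?S" for s t
    proof -
      have "norm (s *\<^sub>R ?a + t *\<^sub>R ?b) \<le> \<bar>s\<bar> + \<bar>t\<bar>"
        using norm_triangle_ineq[of "s *\<^sub>R ?a" "t *\<^sub>R ?b"] by simp
      also have "\<dots> < 2 * d"
        using that by auto
      finally have *: "dist (p + s *\<^sub>R ?a + t *\<^sub>R ?b) p < min d1 d2"
        by (simp add: dist_norm d_def add.assoc)
      then show "p + s *\<^sub>R ?a + t *\<^sub>R ?b \<in> U"
        using d2 by (auto simp: dist_commute)
      show "\<bar>fba (p + s *\<^sub>R ?a + t *\<^sub>R ?b) - ?c\<bar> \<le> e"
        using d1(2)[of "p + s *\<^sub>R ?a + t *\<^sub>R ?b"] * by (simp add: dist_real_def)
    qed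
    \<comment> \<open>Mean value estimate in direction b for \<open>fa\<close> minus its linear
      part; the derivative of the difference is within e of 0.\<close>
    have inner: "\<bar>fa (p + s *\<^sub>R ?a + t *\<^sub>R ?b) - fa (p + s *\<^sub>R ?a) - t * ?c\<bar> \<le> e * \<bar>t\<bar>"
      if "s \<in> ?S" "t \<in> ?S" for s t
    proof -
      define H where "H = (\<lambda>t. fa (p + s *\<^sub>R ?a + t *\<^sub>R ?b) - t * ?c)"
      have "(H has_real_derivative fba (p + s *\<^sub>R ?a + u *\<^sub>R ?b) - ?c) (at u within ?S)" if "u \<in> ?S" for u
        unfolding H_def
        using has_pd_line[OF fba[OF near(1)[OF \<open>s \<in> ?S\<close> that]]]
        unfolding has_real_derivative_iff_has_vector_derivative[symmetric]
        by (auto intro!: derivative_eq_intros intro: has_field_derivative_at_within)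
      then have "norm (H t - H 0) \<le> e * norm (t - 0)"
        by (intro field_differentiable_bound[where S="?S"]) (use that near \<open>d > 0\<close> in auto)
      then show ?thesis
        by (simp add: H_def algebra_simps)
    qed
    \<comment> \<open>Mean value estimate in direction a for the second difference of f: its
      derivative in that direction is an increment of \<open>fa\<close>, which \<open>inner\<close>
      bounds.\<close>
    have outer: "\<bar>(f (p + h *\<^sub>R ?a + k *\<^sub>R ?b) - f (p + h *\<^sub>R ?a)) - (f (p + k *\<^sub>R ?b) - f p) - h * k * ?c\<bar>
        \<le> e * \<bar>k\<bar> * \<bar>h\<bar>" if "h \<in> ?S" "k \<in> ?S" for h k
    proof -
      define H where "H = (\<lambda>t. f (p + k *\<^sub>R ?b + t *\<^sub>R ?a) - f (p + t *\<^sub>R ?a) - t * k * ?c)"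
      have "0 \<in> ?S"
        using \<open>d > 0\<close> by simp
      have "(H has_real_derivative
          fa (p + u *\<^sub>R ?a + k *\<^sub>R ?b) - fa (p + u *\<^sub>R ?a) - k * ?c) (at u within ?S)" if "u \<in> ?S" for u
        unfolding H_def
        using has_pd_line[OF fa, of "p + k *\<^sub>R ?b" u] near(1)[OF that \<open>k \<in> ?S\<close>]
          has_pd_line[OF fa, of p u] near(1)[OF that \<open>0 \<in> ?S\<close>]
        unfolding has_real_derivative_iff_has_vector_derivative[symmetric]
        by (auto intro!: derivative_eq_intros intro: has_field_derivative_at_within simp: algebra_simps)
      then have "norm (H h - H 0) \<le> e * \<bar>k\<bar> * norm (h - 0)"
        by (intro field_differentiable_bound[where S="?S"]) (use that inner \<open>d > 0\<close> in auto)
      then show ?thesis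
        by (simp add: H_def algebra_simps)
    qed
    have "\<bar>fb (p + h *\<^sub>R ?a) - fb p - h * ?c\<bar> \<le> e * \<bar>h\<bar>" if h: "\<bar>h\<bar> < d" for h
    proof -
      have hS: "h \<in> ?S" and zS: "0 \<in> ?S"
        using h \<open>d > 0\<close> by auto
      have lim: "((\<lambda>k. (f (q + k *\<^sub>R ?b) - f q) / k) \<longlongrightarrow> fb q) (at 0)" if "q \<in> U" for q
        using fb[OF that] unfolding has_pd_def has_real_derivative_iff_has_vector_derivative[symmetric]
          has_field_derivative_iff by simp
      \<comment> \<open>Dividing \<open>outer\<close> by k and letting k tend to 0 turns the second
        difference of f into an increment of \<open>fb\<close>, so differentiability of
        \<open>fb\<close> is a result.\<close>
      have "((\<lambda>k. \<bar>(f (p + h *\<^sub>R ?a + k *\<^sub>R ?b) - f (p + h *\<^sub>R ?a)) / k - (f (p + k *\<^sub>R ?b) - f p) / k - h * ?c\<bar>)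
          \<longlongrightarrow> \<bar>fb (p + h *\<^sub>R ?a) - fb p - h * ?c\<bar>) (at 0)"
        using near(1)[OF hS zS] assms(2) by (intro tendsto_intros lim) auto
      moreover have "\<forall>\<^sub>F k in at 0. \<bar>(f (p + h *\<^sub>R ?a + k *\<^sub>R ?b) - f (p + h *\<^sub>R ?a)) / k - (f (p + k *\<^sub>R ?b) - f p) / k - h * ?c\<bar> \<le> e * \<bar>h\<bar>"
        unfolding eventually_at
      proof (intro exI[of _ d] conjI ballI impI \<open>d > 0\<close>)
        fix k :: real assume k: "k \<noteq> 0 \<and> dist k 0 < d"
        have "k * ((f (p + h *\<^sub>R ?a + k *\<^sub>R ?b) - f (p + h *\<^sub>R ?a)) / k - (f (p + k *\<^sub>R ?b) - f p) / k - h * ?c)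
            = (f (p + h *\<^sub>R ?a + k *\<^sub>R ?b) - f (p + h *\<^sub>R ?a)) - (f (p + k *\<^sub>R ?b) - f p) - h * k * ?c"
          using k by (simp add: field_simps)
        then have "\<bar>k * ((f (p + h *\<^sub>R ?a + k *\<^sub>R ?b) - f (p + h *\<^sub>R ?a)) / k - (f (p + k *\<^sub>R ?b) - f p) / k - h * ?c)\<bar> \<le> \<bar>k\<bar> * (e * \<bar>h\<bar>)"
          using outer[OF hS, of k] k by (simp add: dist_real_def abs_less_iff mult_ac)
        then show "\<bar>(f (p + h *\<^sub>R ?a + k *\<^sub>R ?b) - f (p + h *\<^sub>R ?a)) / k - (f (p + k *\<^sub>R ?b) - f p) / k - h * ?c\<bar> \<le> e * \<bar>h\<bar>"
          using k by (simp only: abs_mult) simp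
      qed
      ultimately show ?thesis
        by (intro tendsto_upperbound) auto
    qed
    then show ?thesis
      using \<open>d > 0\<close> by blast
  qed
  note key = this
  have "((\<lambda>h. (fb (p + h *\<^sub>R ?a) - fb p) / h) \<longlongrightarrow> ?c) (at 0)"
    unfolding tendsto_iff
  proof (intro allI impI)
    fix e :: real assume "e > 0"
    then obtain d where d: "d > 0" "\<And>h. 0 < \<bar>h\<bar> \<Longrightarrow> \<bar>h\<bar> < d \<Longrightarrow> \<bar>fb (p + h *\<^sub>R ?a) - fb p - h * ?c\<bar> \<le> e / 2 * \<bar>h\<bar>"
      using key[of "e / 2"] by auto
    have "dist ((fb (p + h *\<^sub>R ?a) - fb p) / h) ?c < e" if "h \<noteq> 0" "\<bar>h\<bar> < d" for h
    proof -
      have "\<bar>(fb (p + h *\<^sub>R ?a) - fb p) / h - ?c\<bar> = \<bar>fb (p + h *\<^sub>R ?a) - fb p - h * ?c\<bar> / \<bar>h\<bar>"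
        using that by (simp add: diff_divide_distrib flip: abs_divide)
      also have "\<dots> \<le> e / 2"
        using d(2)[of h] that by (simp add: divide_simps)
      finally show ?thesis
        using \<open>e > 0\<close> by (simp add: dist_real_def)
    qed
    then show "\<forall>\<^sub>F h in at 0. dist ((fb (p + h *\<^sub>R ?a) - fb p) / h) ?c < e"
      unfolding eventually_at using d(1) by (auto simp: dist_real_def)
  qed
  then show ?thesis
    unfolding has_pd_def has_real_derivative_iff_has_vector_derivative[symmetric] has_field_derivative_iff
    by simp
qed

section \<open>Closure properties of the classes C^k\<close>

lemma Ck_on_cong:
  assumes "open U" "Ck_on k U f" "\<And>q. q \<in> U \<Longrightarrow> f q = g q"
  shows "Ck_on k U g"
  using assms(2,3)
proof (induction k arbitrary: f g)
  case 0
  then show ?case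
    using continuous_on_cong by (metis Ck_on.simps(1))
next
  case (Suc k)
  have "g differentiable_on U"
    using Suc.prems by (metis Ck_on.simps(2) differentiable_on_def differentiable_transform_within zero_less_one)
  moreover have "Ck_on k U (\<partial> a g)" for a
    using Suc.prems by (intro Suc.IH[of "\<partial> a f" "\<partial> a g"] pd_cong[OF assms(1)]) auto
  ultimately show ?case
    by simp
qed

lemma Ck_on_imp_differentiable: "open U \<Longrightarrow> Ck_on (Suc k) U f \<Longrightarrow> p \<in> U \<Longrightarrow> f differentiable (at p)"
  by (auto simp: differentiable_on_eq_differentiable_at)

lemma Ck_on_has_pd: "open U \<Longrightarrow> Ck_on (Suc k) U f \<Longrightarrow> p \<in> U \<Longrightarrow> has_pd a f (\<partial> a f p) p"
  using Ck_on_imp_differentiable has_pd_differentiable by blast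

lemma Ck_on_SucD: "Ck_on (Suc k) U f \<Longrightarrow> Ck_on k U f"
  by (induction k arbitrary: f) (auto intro: differentiable_imp_continuous_on)

lemma Ck_on_mono: "Ck_on k U f \<Longrightarrow> j \<le> k \<Longrightarrow> Ck_on j U f"
proof (induction k)
  case (Suc k)
  then show ?case
    using Ck_on_SucD by (cases "j = Suc k") (auto simp del: Ck_on.simps)
qed simp

lemma Ck_on_pd: "Ck_on (Suc k) U f \<Longrightarrow> Ck_on k U (\<partial> a f)"
  by simp

lemma Ck_on_imp_continuous: "Ck_on k U f \<Longrightarrow> continuous_on U f"
  using Ck_on_mono[of k U f 0] by simp

text \<open>Induction step of the closure proofs: it remains to give a formula for the derivative
  whose class is known by induction.\<close>

lemma Ck_on_SucI:
  assumes "open U" "f differentiable_on U" "\<And>a p. p \<in> U \<Longrightarrow> has_pd a f (F a p) p" "\<And>a. Ck_on k U (F a)"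
  shows "Ck_on (Suc k) U f"
proof -
  have "Ck_on k U (\<partial> a f)" for a
    using assms(3)[THEN pd_eq] by (intro Ck_on_cong[OF assms(1) assms(4)[of a]]) simp
  then show ?thesis
    using assms(2) by simp
qed

named_theorems Ck_intros

lemma Ck_on_const [Ck_intros]: "Ck_on k U (\<lambda>_. c)"
proof (induction k arbitrary: c)
  case (Suc k)
  have "\<partial> a (\<lambda>_. c) = (\<lambda>_. 0)" for a
    by (rule ext, rule pd_eq) (auto intro!: has_pd_intros)
  then show ?case
    using Suc by simp
qed simp

lemma Ck_on_add [Ck_intros]:
  assumes "open U" "Ck_on k U f" "Ck_on k U g"
  shows "Ck_on k U (\<lambda>p. f p + g p)"
  using assms(2,3)
proof (induction k arbitrary: f g)
  case (Suc k)
  show ?case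
    by (rule Ck_on_SucI[OF assms(1), where F="\<lambda>a p. \<partial> a f p + \<partial> a g p"])
       (use Suc in \<open>auto intro!: has_pd_intros Ck_on_has_pd[OF assms(1)] derivative_intros\<close>)
qed (auto intro!: continuous_intros)

lemma Ck_on_mult [Ck_intros]:
  assumes "open U" "Ck_on k U f" "Ck_on k U g"
  shows "Ck_on k U (\<lambda>p. f p * g p)"
  using assms(2,3)
proof (induction k arbitrary: f g)
  case (Suc k)
  show ?case
    by (rule Ck_on_SucI[OF assms(1), where F="\<lambda>a p. \<partial> a f p * g p + f p * \<partial> a g p"])
       (use Suc Suc.prems[THEN Ck_on_SucD] in \<open>auto intro!: has_pd_intros Ck_on_has_pd[OF assms(1)]
          derivative_intros Ck_on_add[OF assms(1)]\<close>)
qed (auto intro!: continuous_intros)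

lemma Ck_on_minus [Ck_intros]: "open U \<Longrightarrow> Ck_on k U f \<Longrightarrow> Ck_on k U (\<lambda>p. - f p)"
  using Ck_on_mult[OF _ Ck_on_const[of k U "-1"], of f] by simp

lemma Ck_on_diff [Ck_intros]: "open U \<Longrightarrow> Ck_on k U f \<Longrightarrow> Ck_on k U g \<Longrightarrow> Ck_on k U (\<lambda>p. f p - g p)"
  using Ck_on_add[OF _ _ Ck_on_minus, of U k f g] by simp

lemma Ck_on_power [Ck_intros]: "open U \<Longrightarrow> Ck_on k U f \<Longrightarrow> Ck_on k U (\<lambda>p. f p ^ n)"
  by (induction n) (auto intro!: Ck_intros)

lemma Ck_on_sum [Ck_intros]: "open U \<Longrightarrow> (\<And>i. i \<in> I \<Longrightarrow> Ck_on k U (f i)) \<Longrightarrow> Ck_on k U (\<lambda>p. \<Sum>i\<in>I. f i p)"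
  by (induction I rule: infinite_finite_induct) (auto intro!: Ck_intros)

lemma Ck_on_inverse [Ck_intros]:
  assumes "open U" "Ck_on k U f" "\<And>p. p \<in> U \<Longrightarrow> f p \<noteq> 0"
  shows "Ck_on k U (\<lambda>p. inverse (f p))"
  using assms(2)
proof (induction k)
  case (Suc k)
  show ?case
    by (rule Ck_on_SucI[OF assms(1), where F="\<lambda>a p. - (\<partial> a f p * inverse (f p) * inverse (f p))"])
       (use Suc assms(3) Ck_on_SucD[OF Suc.prems] in
         \<open>auto intro!: has_pd_inverse Ck_on_has_pd[OF assms(1)] Ck_on_minus Ck_on_mult assms(1)
            simp: differentiable_on_def intro: differentiable_inverse\<close>)
qed (use assms(3) in \<open>auto intro!: continuous_intros\<close>)

lemma Ck_on_powr [Ck_intros]: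
  assumes "open U" "Ck_on k U f" "\<And>p. p \<in> U \<Longrightarrow> f p > 0"
  shows "Ck_on k U (\<lambda>p. f p powr r)"
  using assms(2)
proof (induction k)
  case (Suc k)
  have nz: "f p \<noteq> 0" if "p \<in> U" for p
    using assms(3)[OF that] by simp
  have "(\<lambda>p. f p powr r) differentiable_on U"
    unfolding differentiable_on_def
  proof
    fix p assume "p \<in> U"
    then obtain f' where "(f has_derivative f') (at p within U)"
      using Suc.prems by (auto simp: differentiable_on_def differentiable_def)
    from has_derivative_powr[OF this has_derivative_const[of r] assms(3)[OF \<open>p \<in> U\<close>] \<open>p \<in> U\<close>]
    show "(\<lambda>p. f p powr r) differentiable at p within U"
      by (auto simp: differentiable_def)
  qed
  then show ?case
    by (rule Ck_on_SucI[OF assms(1), where F="\<lambda>a p. r * f p powr r * \<partial> a f p * inverse (f p)"])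
       (use Suc assms(3) nz Ck_on_SucD[OF Suc.prems] in
         \<open>auto intro!: has_pd_powr Ck_on_has_pd[OF assms(1)] Ck_on_mult Ck_on_inverse Ck_on_const assms(1)\<close>)
qed (use less_imp_neq[OF assms(3)] in \<open>auto intro!: continuous_intros\<close>)

lemma pd_commute:
  assumes "open U" "Ck_on (Suc (Suc k)) U f" "p \<in> U"
  shows "\<partial> b (\<partial> a f) p = \<partial> a (\<partial> b f) p"
proof -
  have 1: "Ck_on (Suc k) U (\<partial> a f)" "continuous_on U (\<partial> b (\<partial> a f))" "Ck_on (Suc k) U f"
    using assms(2) Ck_on_SucD[OF assms(2)] Ck_on_imp_continuous[OF Ck_on_pd[OF Ck_on_pd[OF assms(2)]]] by auto
  have "has_pd a (\<partial> b f) (\<partial> b (\<partial> a f) p) p"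
    by (rule has_pd_mixed[OF assms(1,3), where fa="\<partial> a f" and b=b]) (use 1 in \<open>auto intro: Ck_on_has_pd[OF assms(1)] simp del: Ck_on.simps(2)\<close>)
  then show ?thesis
    by (simp add: pd_eq)
qed

section \<open>Partial differentiation by rewriting\<close>

definition pdiff :: "2 \<Rightarrow> (real^2 \<Rightarrow> 'a::real_normed_vector) \<Rightarrow> real^2 \<Rightarrow> bool"
  where "pdiff a f p \<longleftrightarrow> (\<exists>D. has_pd a f D p)"

text \<open>The operator \<open>\<partial>\<close> is total and does not assert existence.
  Separating existence from value makes the rules conditional rewrite equations, so that
  simplification can differentiate the long polynomial expressions.\<close>

lemma has_pd_iff: "has_pd a f D p \<longleftrightarrow> pdiff a f p \<and> \<partial> a f p = D"
  using pd_eq unfolding pdiff_def by metis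

lemma pd_rules:
  fixes f g :: "real^2 \<Rightarrow> real"
  assumes "pdiff a f p" "pdiff a g p"
  shows pdiff_add: "pdiff a (\<lambda>q. f q + g q) p"
    and pdiff_diff: "pdiff a (\<lambda>q. f q - g q) p"
    and pdiff_mult: "pdiff a (\<lambda>q. f q * g q) p"
    and pd_add: "\<partial> a (\<lambda>q. f q + g q) p = \<partial> a f p + \<partial> a g p"
    and pd_diff: "\<partial> a (\<lambda>q. f q - g q) p = \<partial> a f p - \<partial> a g p"
    and pd_mult: "\<partial> a (\<lambda>q. f q * g q) p = \<partial> a f p * g p + f p * \<partial> a g p"
proof -
  have fg: "has_pd a f (\<partial> a f p) p" "has_pd a g (\<partial> a g p) p"
    using assms has_pd_iff by blast+
  show "pdiff a (\<lambda>q. f q + g q) p" "pdiff a (\<lambda>q. f q - g q) p" "pdiff a (\<lambda>q. f q * g q) p"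
    "\<partial> a (\<lambda>q. f q + g q) p = \<partial> a f p + \<partial> a g p"
    "\<partial> a (\<lambda>q. f q - g q) p = \<partial> a f p - \<partial> a g p"
    "\<partial> a (\<lambda>q. f q * g q) p = \<partial> a f p * g p + f p * \<partial> a g p"
    using has_pd_add[OF fg refl] has_pd_diff[OF fg refl] has_pd_mult[OF fg refl]
    by (simp_all add: has_pd_iff)
qed

text \<open>Simplification moves rational factors such as \<open>2/3\<close> into denominators,
  hence the rule for division by a constant.\<close>

lemma pd_rules1:
  fixes f :: "real^2 \<Rightarrow> real"
  assumes "pdiff a f p"
  shows pdiff_minus: "pdiff a (\<lambda>q. - f q) p"
    and pdiff_power: "pdiff a (\<lambda>q. f q ^ n) p"
    and pdiff_divide: "pdiff a (\<lambda>q. f q / c) p"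
    and pd_divide: "\<partial> a (\<lambda>q. f q / c) p = \<partial> a f p / c"
    and pd_minus: "\<partial> a (\<lambda>q. - f q) p = - \<partial> a f p"
    and pd_power: "\<partial> a (\<lambda>q. f q ^ n) p = of_nat n * f p ^ (n - 1) * \<partial> a f p"
proof -
  have f: "has_pd a f (\<partial> a f p) p"
    using assms has_pd_iff by blast
  have "has_pd a (\<lambda>q. f q * (1 / c)) (\<partial> a f p * (1 / c)) p"
    by (rule has_pd_mult[OF f has_pd_const[OF refl]]) simp
  then show "pdiff a (\<lambda>q. f q / c) p" "\<partial> a (\<lambda>q. f q / c) p = \<partial> a f p / c"
    by (simp_all add: has_pd_iff)
  show "pdiff a (\<lambda>q. - f q) p" "pdiff a (\<lambda>q. f q ^ n) p"
    "\<partial> a (\<lambda>q. - f q) p = - \<partial> a f p"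
    "\<partial> a (\<lambda>q. f q ^ n) p = of_nat n * f p ^ (n - 1) * \<partial> a f p"
    using has_pd_minus[OF f refl] has_pd_power[OF f refl]
    by (simp_all add: has_pd_iff)
qed

lemma pd_rules0:
  shows pdiff_const: "pdiff a (\<lambda>_. c) p"
    and pd_const: "\<partial> a (\<lambda>_. c) p = 0"
  using has_pd_const[OF refl] unfolding has_pd_iff by blast+

lemmas pd_simps = pd_rules pd_rules1 pd_rules0

text \<open>The commutation equations move \<open>\<partial>\<^sub>x\<close> outermost and so give
  normal forms of the derivatives up to order three that occur. Identities between coefficients then
  become polynomial identities in independent symbols. Order three has its own equations because a
  pointwise equation does not rewrite under a derivative.\<close>

lemma jets:
  assumes "open U" "Ck_on 5 U f"
  shows "k \<le> 5 \<Longrightarrow> Ck_on k U f"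
    and "k \<le> 4 \<Longrightarrow> Ck_on k U (\<partial> a f)"
    and "k \<le> 3 \<Longrightarrow> Ck_on k U (\<partial> a (\<partial> b f))"
    and "p \<in> U \<Longrightarrow> pdiff a f p"
    and "p \<in> U \<Longrightarrow> pdiff a (\<partial> b f) p"
    and "p \<in> U \<Longrightarrow> pdiff a (\<partial> b (\<partial> c f)) p"
    and "p \<in> U \<Longrightarrow> \<partial> 2 (\<partial> 1 f) p = \<partial> 1 (\<partial> 2 f) p"
    and "p \<in> U \<Longrightarrow> \<partial> 2 (\<partial> 1 (\<partial> 2 f)) p = \<partial> 1 (\<partial> 2 (\<partial> 2 f)) p"
    and "p \<in> U \<Longrightarrow> \<partial> 2 (\<partial> 1 (\<partial> 1 f)) p = \<partial> 1 (\<partial> 1 (\<partial> 2 f)) p"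
proof -
  have 5: "Ck_on (Suc (Suc (Suc 2))) U f"
    using assms(2) by (simp add: numeral_eq_Suc)
  have 4: "Ck_on (Suc (Suc 2)) U (\<partial> a f)" for a
    using 5 by (rule Ck_on_pd)
  have 3: "Ck_on (Suc 2) U (\<partial> a (\<partial> b f))" for a b
    using 4 by (rule Ck_on_pd)
  show "k \<le> 5 \<Longrightarrow> Ck_on k U f"
    using assms(2) Ck_on_mono by blast
  show "k \<le> 4 \<Longrightarrow> Ck_on k U (\<partial> a f)"
    by (rule Ck_on_mono[OF 4]) simp
  show "k \<le> 3 \<Longrightarrow> Ck_on k U (\<partial> a (\<partial> b f))"
    by (rule Ck_on_mono[OF 3]) simp
  show "pdiff a f p" "pdiff a (\<partial> b f) p" "pdiff a (\<partial> b (\<partial> c f)) p" if "p \<in> U"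
    using Ck_on_has_pd[OF assms(1) _ that] 5 4 3 unfolding pdiff_def by blast+
  show c1: "\<partial> 2 (\<partial> 1 f) p = \<partial> 1 (\<partial> 2 f) p" if "p \<in> U" for p
    by (rule pd_commute[OF assms(1) 5 that])
  show "\<partial> 2 (\<partial> 1 (\<partial> 2 f)) p = \<partial> 1 (\<partial> 2 (\<partial> 2 f)) p" if "p \<in> U"
    by (rule pd_commute[OF assms(1) 4 that])
  show "\<partial> 2 (\<partial> 1 (\<partial> 1 f)) p = \<partial> 1 (\<partial> 1 (\<partial> 2 f)) p" if "p \<in> U"
    using pd_commute[OF assms(1) 4 that, where b=2 and a=1] pd_cong[OF assms(1) that c1, where a=1] by simp
qed

section \<open>The prolonged Liouville system\<close>

lemma exhaust_6:
  fixes x :: 6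
  shows "x = 1 \<or> x = 2 \<or> x = 3 \<or> x = 4 \<or> x = 5 \<or> x = 6"
proof (induct x)
  case (of_int z)
  then have "0 \<le> z" and "z < 6"
    by simp_all
  then have "z = 0 \<or> z = 1 \<or> z = 2 \<or> z = 3 \<or> z = 4 \<or> z = 5"
    by arith
  then show ?case
    by auto
qed

lemma forall_6: "(\<forall>i::6. P i) \<longleftrightarrow> P 1 \<and> P 2 \<and> P 3 \<and> P 4 \<and> P 5 \<and> P 6"
  by (metis exhaust_6)

lemma sum_6: "sum f (UNIV::6 set) = f 1 + f 2 + f 3 + f 4 + f 5 + f 6"
proof -
  have "(UNIV::6 set) = {1, 2, 3, 4, 5, 6}"
    using exhaust_6 by auto
  then have "sum f (UNIV::6 set) = sum f {1, 2, 3, 4, 5, 6}"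
    by (rule arg_cong)
  also have "\<dots> = f 1 + f 2 + f 3 + f 4 + f 5 + f 6"
    by (simp add: add.assoc)
  finally show ?thesis .
qed

lemma vector_6 [simp]:
  "(vector [a, b, c, d, e, f] :: 'a::zero^6) $ 1 = a"
  "(vector [a, b, c, d, e, f] :: 'a::zero^6) $ 2 = b"
  "(vector [a, b, c, d, e, f] :: 'a::zero^6) $ 3 = c"
  "(vector [a, b, c, d, e, f] :: 'a::zero^6) $ 4 = d"
  "(vector [a, b, c, d, e, f] :: 'a::zero^6) $ 5 = e"
  "(vector [a, b, c, d, e, f] :: 'a::zero^6) $ 6 = f"
  unfolding vector_def by simp_all

text \<open>Liouville's linear system. For a metric \<open>E dx\<^sup>2 + 2 F dx dy + G dy\<^sup>2\<close> with determinant \<open>\<Delta>\<close>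
  a solution is \<open>(z1, z2, z3) = \<bar>\<Delta>\<bar> powr (- 2/3) * (E, F, G)\<close>.\<close>

locale liouville_system = cubic_ode A0 A1 A2 A3 for A0 A1 A2 A3 +
  fixes U :: "(real^2) set" and z1 z2 z3 :: "real^2 \<Rightarrow> real"
  assumes openU: "open U"
    and C5: "Ck_on 5 U A0" "Ck_on 5 U A1" "Ck_on 5 U A2" "Ck_on 5 U A3"
    and C2: "Ck_on 2 U z1" "Ck_on 2 U z2" "Ck_on 2 U z3"
    and z1x: "p \<in> U \<Longrightarrow> \<partial> 1 z1 p = 2/3 * A1 p * z1 p - 2 * A0 p * z2 p"
    and z1y: "p \<in> U \<Longrightarrow> \<partial> 2 z1 p = 4/3 * A2 p * z1 p - 2/3 * A1 p * z2 p - 2 * A0 p * z3 p - 2 * \<partial> 1 z2 p"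
    and z3x: "p \<in> U \<Longrightarrow> \<partial> 1 z3 p = 2 * A3 p * z1 p + 2/3 * A2 p * z2 p - 4/3 * A1 p * z3 p - 2 * \<partial> 2 z2 p"
    and z3y: "p \<in> U \<Longrightarrow> \<partial> 2 z3 p = 2 * A3 p * z2 p - 2/3 * A2 p * z3 p"
begin

text \<open>Liouville's four equations leave two of the six first derivatives of z free: these are
  \<open>m\<close> and \<open>n\<close>. Among the derivatives of \<open>m\<close> and
  \<open>n\<close> only \<open>r\<close> stays free. The factor 2 fits the coefficient of the mixed
  terms in the system.\<close>

definition m :: "real^2 \<Rightarrow> real" where "m p = 2 * \<partial> 1 z2 p"
definition n :: "real^2 \<Rightarrow> real" where "n p = 2 * \<partial> 2 z2 p"
definition r :: "real^2 \<Rightarrow> real" where "r p = \<partial> 2 m p"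

definition Psi :: "real^2 \<Rightarrow> real^6" where "Psi p = vector [z1 p, z2 p, z3 p, m p, n p, r p]"

lemmas jet0 = jets[OF openU C5(1)]
lemmas jet1 = jets[OF openU C5(2)]
lemmas jet2 = jets[OF openU C5(3)]
lemmas jet3 = jets[OF openU C5(4)]
lemmas jets_A = jet0 jet1 jet2 jet3

lemmas coeff_defs = a41_def a42_def a43_def a61_def a62_def a63_def a64_def a65_def
  b51_def b52_def b53_def b61_def b62_def b63_def b64_def b65_def

lemma C1_mn: "Ck_on 1 U m" "Ck_on 1 U n"
proof -
  have z2: "Ck_on (Suc 1) U z2"
    using C2 by (simp add: numeral_2_eq_2)
  show "Ck_on 1 U m" "Ck_on 1 U n"
    unfolding m_def[abs_def] n_def[abs_def] by (intro Ck_intros openU Ck_on_pd[OF z2])+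
qed

lemma continuous:
  "continuous_on U z1" "continuous_on U z2" "continuous_on U z3"
  "continuous_on U m" "continuous_on U n" "continuous_on U r"
proof -
  show "continuous_on U z1" "continuous_on U z2" "continuous_on U z3"
    "continuous_on U m" "continuous_on U n"
    using C2 C1_mn Ck_on_imp_continuous by blast+
  show "continuous_on U r"
    using C1_mn(1) unfolding r_def[abs_def] by simp
qed

lemma pdiff_z:
  assumes "p \<in> U"
  shows "pdiff a z1 p" "pdiff a z2 p" "pdiff a z3 p" "pdiff a m p" "pdiff a n p"
  using C2 C1_mn Ck_on_has_pd[OF openU _ assms] unfolding pdiff_def numeral_2_eq_2 One_nat_def
  by blast+

lemma pd_z:
  assumes "p \<in> U"
  shows "\<partial> 1 z1 p = 2/3 * A1 p * z1 p - 2 * A0 p * z2 p"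
    and "\<partial> 2 z1 p = 4/3 * A2 p * z1 p - 2/3 * A1 p * z2 p - 2 * A0 p * z3 p - m p"
    and "\<partial> 1 z2 p = m p / 2"
    and "\<partial> 2 z2 p = n p / 2"
    and "\<partial> 1 z3 p = 2 * A3 p * z1 p + 2/3 * A2 p * z2 p - 4/3 * A1 p * z3 p - n p"
    and "\<partial> 2 z3 p = 2 * A3 p * z2 p - 2/3 * A2 p * z3 p"
    and "\<partial> 2 m p = r p"
  using z1x z1y z3x z3y assms by (auto simp: m_def n_def r_def)

text \<open>Both sides are twice the mixed second derivative of \<open>z2\<close>.\<close>

lemma pd1_n: "p \<in> U \<Longrightarrow> \<partial> 1 n p = r p"
proof -
  assume p: "p \<in> U"
  have z2: "Ck_on (Suc (Suc 0)) U z2"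
    using C2 by (simp add: numeral_2_eq_2)
  have "pdiff 1 (\<partial> 2 z2) p" "pdiff 2 (\<partial> 1 z2) p"
    using Ck_on_has_pd[OF openU Ck_on_pd[OF z2] p] unfolding pdiff_def by blast+
  then show ?thesis
    using pd_commute[OF openU z2 p, of 1 2]
    by (simp add: r_def n_def[abs_def] m_def[abs_def] pd_simps)
qed

text \<open>The compatibility condition for \<open>z1\<close> contains the x derivative of
  \<open>m\<close> linearly; solving for it gives the fourth row of \<open>Omega1\<close>.\<close>

lemma pd1_m:
  assumes p: "p \<in> U"
  shows "\<partial> 1 m p = - (a41 p * z1 p + a42 p * z2 p + a43 p * z3 p - 1/3 * A1 p * m p - 3 * A0 p * n p)"
    (is "_ = ?rhs")
proof -
  let ?z1x = "\<lambda>q. 2/3 * A1 q * z1 q - 2 * A0 q * z2 q"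
  let ?z1y = "\<lambda>q. 4/3 * A2 q * z1 q - 2/3 * A1 q * z2 q - 2 * A0 q * z3 q - m q"
  have "Ck_on (Suc (Suc 0)) U z1"
    using C2 by (simp add: numeral_2_eq_2)
  then have "\<partial> 2 (\<partial> 1 z1) p = \<partial> 1 (\<partial> 2 z1) p"
    using p by (rule pd_commute[OF openU])
  then have "\<partial> 2 ?z1x p = \<partial> 1 ?z1y p"
    using pd_cong[OF openU p pd_z(1), where a=2] pd_cong[OF openU p pd_z(2), where a=1] by simp
  \<comment> \<open>Since \<open>m\<close> enters \<open>?z1y\<close> with coefficient -1, the
    failure of compatibility is exactly the error of the claimed formula.\<close>
  moreover have "\<partial> 1 m p - ?rhs = \<partial> 2 ?z1x p - \<partial> 1 ?z1y p"
    using p by (simp add: pd_simps jets_A pdiff_z pd_z coeff_defs) (simp add: field_simps power2_eq_square)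
  ultimately show ?thesis
    by simp
qed

text \<open>The compatibility condition for \<open>z3\<close>, solved for the y derivative of
  \<open>n\<close>; it gives the fifth row of \<open>Omega2\<close>.\<close>

lemma pd2_n:
  assumes p: "p \<in> U"
  shows "\<partial> 2 n p = - (b51 p * z1 p + b52 p * z2 p + b53 p * z3 p + 3 * A3 p * m p + 1/3 * A2 p * n p)"
    (is "_ = ?rhs")
proof -
  let ?z3x = "\<lambda>q. 2 * A3 q * z1 q + 2/3 * A2 q * z2 q - 4/3 * A1 q * z3 q - n q"
  let ?z3y = "\<lambda>q. 2 * A3 q * z2 q - 2/3 * A2 q * z3 q"
  have "Ck_on (Suc (Suc 0)) U z3"
    using C2 by (simp add: numeral_2_eq_2)
  then have "\<partial> 2 (\<partial> 1 z3) p = \<partial> 1 (\<partial> 2 z3) p"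
    using p by (rule pd_commute[OF openU])
  then have "\<partial> 2 ?z3x p = \<partial> 1 ?z3y p"
    using pd_cong[OF openU p pd_z(5), where a=2] pd_cong[OF openU p pd_z(6), where a=1] by simp
  moreover have "\<partial> 2 n p - ?rhs = \<partial> 1 ?z3y p - \<partial> 2 ?z3x p"
    using p by (simp add: pd_simps jets_A pdiff_z pd_z coeff_defs) (simp add: field_simps power2_eq_square)
  ultimately show ?thesis
    by simp
qed

section \<open>Differentiability of the last prolonged variable\<close>

lemma Ck_coeffs:
  "Ck_on 3 U a41" "Ck_on 3 U a42" "Ck_on 3 U a43"
  "Ck_on 3 U a61" "Ck_on 3 U a62" "Ck_on 3 U a63" "Ck_on 3 U a64" "Ck_on 3 U a65"
  "Ck_on 3 U b51" "Ck_on 3 U b52" "Ck_on 3 U b53"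
  "Ck_on 3 U b61" "Ck_on 3 U b62" "Ck_on 3 U b63" "Ck_on 3 U b64" "Ck_on 3 U b65"
  unfolding coeff_defs[abs_def] by (intro Ck_intros openU jets_A; simp)+

lemma Ck_L: "Ck_on 3 U L1" "Ck_on 3 U L2"
  unfolding L1_def[abs_def] L2_def[abs_def] by (intro Ck_intros openU jets_A; simp)+

text \<open>Minus the last row of \<open>Omega1\<close> applied to \<open>Psi\<close>: the outcome
  of differentiating the formula in \<open>pd1_m\<close> along y. Likewise \<open>r_y\<close> comes
  from \<open>pd2_n\<close> and \<open>Omega2\<close>.\<close>

definition r_x :: "real^2 \<Rightarrow> real"
  where "r_x p = - (a61 p * z1 p + a62 p * z2 p + a63 p * z3 p + a64 p * m p + a65 p * n p - 1/3 * A1 p * r p)"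

definition r_y :: "real^2 \<Rightarrow> real"
  where "r_y p = - (b61 p * z1 p + b62 p * z2 p + b63 p * z3 p + b64 p * m p + b65 p * n p + 1/3 * A2 p * r p)"

lemma continuous_r: "continuous_on U r_x" "continuous_on U r_y"
  unfolding r_x_def[abs_def] r_y_def[abs_def]
  by (intro continuous_intros continuous Ck_coeffs[THEN Ck_on_imp_continuous] C5[THEN Ck_on_imp_continuous])+

text \<open>Only here Peano's form of Schwarz's theorem is needed: a metric of class \<open>C\<^sup>2\<close> makes
  \<^term>\<open>r\<close> a priori merely continuous.\<close>

lemma has_pd_r:
  assumes p: "p \<in> U"
  shows "has_pd 1 r (r_x p) p" "has_pd 2 r (r_y p) p"
proof -
  show "has_pd 1 r (r_x p) p"
  \<comment> \<open>Schwarz's theorem for \<open>m\<close>: the explicit formula for its x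
    derivative can be differentiated along y, hence its y derivative \<open>r\<close> can be
    differentiated along x.\<close>
  proof (rule has_pd_mixed[OF openU p _ _ _ continuous_r(1)])
    show "has_pd 1 m (- (a41 q * z1 q + a42 q * z2 q + a43 q * z3 q - 1/3 * A1 q * m q - 3 * A0 q * n q)) q"
      if "q \<in> U" for q
      using that by (simp add: has_pd_iff pdiff_z pd1_m)
    show "has_pd 2 m (r q) q" if "q \<in> U" for q
      using that by (simp add: has_pd_iff pdiff_z pd_z)
    show "has_pd 2 (\<lambda>q. - (a41 q * z1 q + a42 q * z2 q + a43 q * z3 q - 1/3 * A1 q * m q - 3 * A0 q * n q)) (r_x q) q"
      if "q \<in> U" for q
      using that by (simp add: has_pd_iff coeff_defs pd_simps jets_A pdiff_z pd_z pd2_n r_x_def) (simp add: field_simps power2_eq_square)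
  qed
  show "has_pd 2 r (r_y p) p"
  \<comment> \<open>The same for \<open>n\<close> with the directions exchanged; here
    \<open>r\<close> appears as the x derivative of \<open>n\<close>.\<close>
  proof (rule has_pd_mixed[OF openU p _ _ _ continuous_r(2)])
    show "has_pd 2 n (- (b51 q * z1 q + b52 q * z2 q + b53 q * z3 q + 3 * A3 q * m q + 1/3 * A2 q * n q)) q"
      if "q \<in> U" for q
      using that by (simp add: has_pd_iff pdiff_z pd2_n)
    show "has_pd 1 n (r q) q" if "q \<in> U" for q
      using that by (simp add: has_pd_iff pdiff_z pd1_n)
    show "has_pd 1 (\<lambda>q. - (b51 q * z1 q + b52 q * z2 q + b53 q * z3 q + 3 * A3 q * m q + 1/3 * A2 q * n q)) (r_y q) q"
      if "q \<in> U" for q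
      using that by (simp add: has_pd_iff coeff_defs pd_simps jets_A pdiff_z pd_z pd1_n pd1_m r_y_def) (simp add: field_simps power2_eq_square)
  qed
qed

lemma pdiff_r: "p \<in> U \<Longrightarrow> pdiff a r p"
  and pd_r: "p \<in> U \<Longrightarrow> \<partial> 1 r p = r_x p" "p \<in> U \<Longrightarrow> \<partial> 2 r p = r_y p"
  using has_pd_r exhaust_2[of a] by (auto simp: has_pd_iff)

lemma has_pd_Psi:
  assumes p: "p \<in> U"
  shows "has_pd a Psi (- (Omega a p *v Psi p)) p"
proof (rule has_pd_vec)
  fix i :: 6
  have "\<forall>a i. has_pd a (\<lambda>q. Psi q $ i) ((- (Omega a p *v Psi p)) $ i) p"
    using p unfolding forall_2 forall_6
    by (simp add: has_pd_iff Psi_def Omega_def Omega1_def Omega2_def matrix_vector_mult_def sum_6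
      pdiff_z pd_z pd1_n pd1_m pd2_n pdiff_r pd_r r_x_def r_y_def)
  then show "has_pd a (\<lambda>q. Psi q $ i) ((- (Omega a p *v Psi p)) $ i) p"
    by blast
qed

lemma coeff_jets:
  assumes p: "p \<in> U" and "f \<in> {a61, a62, a63, a64, a65, b61, b62, b63, b64, b65, L1, L2}"
  shows "pdiff a f p"
proof -
  have "Ck_on (Suc 2) U f"
    using assms(2) Ck_coeffs Ck_L by (auto simp: eval_nat_numeral simp del: Ck_on.simps)
  then show ?thesis
    using Ck_on_has_pd[OF openU _ p] unfolding pdiff_def by blast
qed

text \<open>The first derivatives of \<open>r\<close> are now explicit in the components of
  \<open>Psi\<close>, all of which are differentiable, so Schwarz's theorem applies once more, to
  \<open>r\<close> itself.\<close>

lemma r_mixed: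
  assumes p: "p \<in> U"
  shows "\<partial> 2 r_x p = \<partial> 1 r_y p"
proof -
  have pdiff: "pdiff a r_x p" "pdiff a r_y p" if "p \<in> U" for a p
    unfolding r_x_def[abs_def] r_y_def[abs_def]
    using that by (simp_all add: pd_simps coeff_jets pdiff_z jets_A pdiff_r)
  have "has_pd 1 r_y (\<partial> 2 r_x p) p"
  proof (rule has_pd_mixed[OF openU p, where f=r and fa=r_x and b=2])
    \<comment> \<open>The y derivative of \<open>r_x\<close> after substitution of the closed
      system; in this form it contains no derivative of \<open>Psi\<close>, and continuity can be
      read off.\<close>
    have "continuous_on U (\<lambda>q. - (\<partial> 2 a61 q * z1 q + a61 q * (4/3 * A2 q * z1 q - 2/3 * A1 q * z2 q - 2 * A0 q * z3 q - m q)
      + (\<partial> 2 a62 q * z2 q + a62 q * (1/2 * n q))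
      + (\<partial> 2 a63 q * z3 q + a63 q * (2 * A3 q * z2 q - 2/3 * A2 q * z3 q))
      + (\<partial> 2 a64 q * m q + a64 q * r q)
      + (\<partial> 2 a65 q * n q - a65 q * (b51 q * z1 q + b52 q * z2 q + b53 q * z3 q + 3 * A3 q * m q + 1/3 * A2 q * n q))
      - (1/3 * \<partial> 2 A1 q * r q + 1/3 * A1 q * r_y q)))" (is "continuous_on U ?g")
    proof -
      have "Ck_on (Suc 2) U a61" "Ck_on (Suc 2) U a62" "Ck_on (Suc 2) U a63" "Ck_on (Suc 2) U a64" "Ck_on (Suc 2) U a65"
        using Ck_coeffs by (simp_all add: eval_nat_numeral del: Ck_on.simps)
      note pds = this[THEN Ck_on_pd, of 2, THEN Ck_on_imp_continuous]
      have A1y: "continuous_on U (\<partial> 2 A1)"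
        by (rule Ck_on_imp_continuous, rule jet1(2), rule le0)
      show ?thesis
        by (intro continuous_on_minus continuous_on_add continuous_on_diff continuous_on_mult continuous_on_const
          continuous continuous_r pds A1y
          Ck_coeffs[THEN Ck_on_imp_continuous] C5[THEN Ck_on_imp_continuous])
    qed
    moreover have "\<partial> 2 r_x q = ?g q" if "q \<in> U" for q
      unfolding r_x_def[abs_def]
      using that by (simp add: pd_simps coeff_jets pdiff_z jets_A pdiff_r pd_z pd2_n pd_r)
        (simp add: field_simps)
    ultimately show "continuous_on U (\<partial> 2 r_x)"
      using continuous_on_cong by force
  qed (use pdiff in \<open>auto simp: has_pd_iff pdiff_r pd_r\<close>)
  then show ?thesis
    by (simp add: has_pd_iff)
qed

text \<open>\<^term>\<open>V\<close> is the last row of the curvature \<open>\<partial>\<^sub>x \<Omega>\<^sub>2 - \<partial>\<^sub>y \<Omega>\<^sub>1 + [\<Omega>\<^sub>1, \<Omega>\<^sub>2]\<close>; the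
  other rows vanish, being the integrability conditions that define \<^term>\<open>m\<close>, \<^term>\<open>n\<close>
  and \<^term>\<open>r\<close>.\<close>

lemma curvature_1:
  assumes "p \<in> U"
  shows "V p $ 1 = - (\<partial> 2 a61 p + 4/3 * A2 p * a61 p - a65 p * b51 p + 1/3 * A1 p * b61 p)
    + (\<partial> 1 b61 p + 2/3 * A1 p * b61 p + 2 * A3 p * b63 p - b64 p * a41 p - 1/3 * A2 p * a61 p)"
  using assms by (simp add: V_def coeff_defs[abs_def] L1_def[abs_def] L2_def[abs_def] pd_simps jets_A,
    simp add: field_simps power2_eq_square)

lemma curvature_2:
  assumes "p \<in> U"
  shows "V p $ 2 = - (\<partial> 2 a62 p - 2/3 * A1 p * a61 p + 2 * A3 p * a63 p - a65 p * b52 p + 1/3 * A1 p * b62 p)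
    + (\<partial> 1 b62 p - 2 * A0 p * b61 p + 2/3 * A2 p * b63 p - b64 p * a42 p - 1/3 * A2 p * a62 p)"
  using assms by (simp add: V_def coeff_defs[abs_def] L1_def[abs_def] L2_def[abs_def] pd_simps jets_A,
    simp add: field_simps power2_eq_square)

lemma curvature_3:
  assumes "p \<in> U"
  shows "V p $ 3 = - (\<partial> 2 a63 p - 2 * A0 p * a61 p - 2/3 * A2 p * a63 p - a65 p * b53 p + 1/3 * A1 p * b63 p)
    + (\<partial> 1 b63 p - 4/3 * A1 p * b63 p - b64 p * a43 p - 1/3 * A2 p * a63 p)"
  using assms by (simp add: V_def coeff_defs[abs_def] L1_def[abs_def] L2_def[abs_def] pd_simps jets_A,
    simp add: field_simps power2_eq_square)

lemma curvature_4:
  assumes "p \<in> U"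
  shows "V p $ 4 = - (\<partial> 2 a64 p - a61 p - 3 * A3 p * a65 p + 1/3 * A1 p * b64 p)
    + (\<partial> 1 b64 p + 1/2 * b62 p + 1/3 * A1 p * b64 p - 1/3 * A2 p * a64 p)"
  using assms by (simp add: V_def coeff_defs[abs_def] L1_def[abs_def] L2_def[abs_def] pd_simps jets_A,
    simp add: field_simps power2_eq_square)

lemma curvature_5:
  assumes "p \<in> U"
  shows "V p $ 5 = - (\<partial> 2 a65 p + 1/2 * a62 p - 1/3 * A2 p * a65 p + 1/3 * A1 p * b65 p)
    + (\<partial> 1 b65 p - b63 p + 3 * A0 p * b64 p - 1/3 * A2 p * a65 p)"
  using assms by (simp add: V_def coeff_defs[abs_def] L1_def[abs_def] L2_def[abs_def] pd_simps jets_A,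
    simp add: field_simps power2_eq_square)

lemma curvature_6:
  assumes "p \<in> U"
  shows "V p $ 6 = - (a64 p - 1/3 * \<partial> 2 A1 p) + (b65 p + 1/3 * \<partial> 1 A2 p)"
  using assms by (simp add: V_def coeff_defs)

text \<open>After substitution of the closed system, the difference of the two mixed derivatives of
  \<open>r\<close> is linear in \<open>Psi\<close>, and its coefficients are the curvature entries
  just computed.\<close>

lemma V_Psi:
  assumes p: "p \<in> U"
  shows "V p \<bullet> Psi p = 0"
proof -
  have "V p \<bullet> Psi p = \<partial> 2 r_x p - \<partial> 1 r_y p"
    unfolding r_x_def[abs_def] r_y_def[abs_def] inner_vec_def sum_6
      curvature_1[OF p] curvature_2[OF p] curvature_3[OF p] curvature_4[OF p] curvature_5[OF p] curvature_6[OF p]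
    using p
    by (simp add: Psi_def pd_simps coeff_jets pdiff_z jets_A pdiff_r pd_z pd2_n pd1_m pd1_n pd_r,
      simp add: r_x_def r_y_def, simp add: field_simps)
  then show ?thesis
    using r_mixed[OF p] by simp
qed

section \<open>The rows of the matrix annihilate \<open>Psi\<close>\<close>

lemma Ck_V: "Ck_on 2 U (\<lambda>p. V p $ i)"
proof -
  have "Ck_on (Suc 2) U L1" "Ck_on (Suc 2) U L2"
    using Ck_L by (simp_all add: eval_nat_numeral del: Ck_on.simps)
  note L = this this[THEN Ck_on_SucD] this[THEN Ck_on_pd]
  have "\<forall>i. Ck_on 2 U (\<lambda>p. V p $ i)"
    unfolding forall_6 V_def vector_6 by (intro conjI Ck_intros openU L jets_A; simp)
  then show ?thesis
    by blast
qed

lemma Ck_Omega: "Ck_on 3 U (\<lambda>p. Omega a p $ i $ j)"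
proof -
  have "\<forall>i j. Ck_on 3 U (\<lambda>p. Omega1 p $ i $ j)" "\<forall>i j. Ck_on 3 U (\<lambda>p. Omega2 p $ i $ j)"
    unfolding forall_6 Omega1_def Omega2_def vector_6
    by (intro conjI Ck_intros openU Ck_coeffs jets_A; simp)+
  then show ?thesis
    by (cases "a = 1") (simp_all add: Omega_def del: Ck_on.simps)
qed

lemma has_pd_Ck_vec:
  fixes W :: "real^2 \<Rightarrow> real^6"
  assumes "\<And>i. Ck_on (Suc k) U (\<lambda>p. W p $ i)" "p \<in> U"
  shows "has_pd a W (\<chi> i. \<partial> a (\<lambda>q. W q $ i) p) p"
  using Ck_on_has_pd[OF openU assms] by (intro has_pd_vec) simp

text \<open>Each application of \<open>D\<close> costs one derivative; the bound on k is the class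
  of \<open>Omega\<close>.\<close>

lemma Ck_D:
  assumes "\<And>i. Ck_on (Suc k) U (\<lambda>p. W p $ i)" "k \<le> 3"
  shows "Ck_on k U (\<lambda>p. D a W p $ i)"
proof (rule Ck_on_cong[OF openU])
  show "Ck_on k U (\<lambda>p. \<partial> a (\<lambda>q. W q $ i) p - (\<Sum>j\<in>UNIV. W p $ j * Omega a p $ j $ i))"
    using assms Ck_on_pd[OF assms(1)[of i], of a] Ck_on_SucD[OF assms(1)] Ck_on_mono[OF Ck_Omega]
    by (intro Ck_intros openU) auto
  show "\<partial> a (\<lambda>q. W q $ i) p - (\<Sum>j\<in>UNIV. W p $ j * Omega a p $ j $ i) = D a W p $ i" if "p \<in> U" for p
    using pd_eq[OF has_pd_Ck_vec[OF assms(1) that], of a] by (simp add: D_def vector_matrix_mult_def)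
qed

text \<open>\<open>D\<close> is the dual, on row vectors, of the connection for which
  \<open>Psi\<close> is parallel. By the Leibniz rule the derivative of the pairing of W with
  \<open>Psi\<close> is the pairing of \<open>D a W\<close> with \<open>Psi\<close>.\<close>

lemma D_annihilates:
  assumes "\<And>i. Ck_on (Suc k) U (\<lambda>p. W p $ i)" "\<And>q. q \<in> U \<Longrightarrow> W q \<bullet> Psi q = 0" "p \<in> U"
  shows "D a W p \<bullet> Psi p = 0"
proof -
  have "has_pd a W (\<partial> a W p) p"
    using has_pd_Ck_vec[OF assms(1,3)] pd_eq by metis
  then have "has_pd a (\<lambda>q. W q \<bullet> Psi q) (\<partial> a W p \<bullet> Psi p + W p \<bullet> - (Omega a p *v Psi p)) p"
    using has_pd_Psi[OF assms(3)] by (rule has_pd_inner)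
  then have "has_pd a (\<lambda>_. 0) (\<partial> a W p \<bullet> Psi p + W p \<bullet> - (Omega a p *v Psi p)) p"
    using assms(2) by (rule has_pd_cong[OF _ openU assms(3)])
  then have "\<partial> a W p \<bullet> Psi p - W p \<bullet> (Omega a p *v Psi p) = 0"
    by (simp add: has_pd_iff pd_const)
  then show ?thesis
    by (simp add: D_def inner_diff_left dot_lmul_matrix)
qed

text \<open>Class C^2 of \<open>V\<close> allows exactly the two applications of \<open>D\<close> in
  the last three rows. That \<open>Psi\<close> is nonzero is seen on its first three entries, which
  for a metric are multiples of its components.\<close>

lemma det_M:
  assumes p: "p \<in> U" and nz: "z1 p \<noteq> 0 \<or> z2 p \<noteq> 0 \<or> z3 p \<noteq> 0"
  shows "det (M p) = 0"
proof -
  have V: "Ck_on (Suc (Suc 0)) U (\<lambda>p. V p $ i)" for i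
    using Ck_V by (simp add: numeral_2_eq_2)
  have DV: "Ck_on (Suc 0) U (\<lambda>p. D a V p $ i)" for a i
    by (rule Ck_D[OF V]) simp
  have D1: "D a V q \<bullet> Psi q = 0" if "q \<in> U" for a q
    using V V_Psi that by (rule D_annihilates)
  have D2: "D b (D a V) p \<bullet> Psi p = 0" for a b
    using DV D1 p by (rule D_annihilates)
  have "\<forall>i. M p $ i \<bullet> Psi p = 0"
    unfolding forall_6 M_def using V_Psi[OF p] D1[OF p] D2
    by (simp add: symD_def inner_add_left)
  then have "M p *v Psi p = 0"
    by (simp add: vec_eq_iff matrix_vector_mul_component)
  moreover have "Psi p \<noteq> 0"
    using nz by (auto simp: Psi_def vec_eq_iff forall_6)
  ultimately show ?thesis
    using invertible_det_nz[of "M p"] matrix_left_invertible_ker[of "M p"] unfolding invertible_def by blast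
qed

end

section \<open>The Liouville system of a metric\<close>

lemma metric_on_sym:
  assumes "metric_on U g" "p \<in> U"
  shows "g p $ b $ a = g p $ a $ b"
proof -
  have "transpose (g p) $ a $ b = g p $ a $ b"
    using assms by (simp add: metric_on_def)
  then show ?thesis
    by (simp add: transpose_def)
qed

lemma metric_on_det:
  assumes "metric_on U g" "p \<in> U"
  shows "det (g p) = g p $ 1 $ 1 * g p $ 2 $ 2 - g p $ 1 $ 2 * g p $ 1 $ 2"
  using metric_on_sym[OF assms, of 2 1] by (simp add: det_2)

lemma levi_civita_on_pd:
  assumes "levi_civita_on U g \<Gamma>" "p \<in> U"
  shows "\<partial> a (\<lambda>q. g q $ b $ c) p = \<Gamma> 1 a b p * g p $ 1 $ c + \<Gamma> 2 a b p * g p $ 2 $ c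
      + (\<Gamma> 1 a c p * g p $ b $ 1 + \<Gamma> 2 a c p * g p $ b $ 2)"
proof -
  have "\<partial> a (\<lambda>q. g q $ b $ c) p
      - (\<Sum>d\<in>UNIV. \<Gamma> d a b p * g p $ d $ c) - (\<Sum>d\<in>UNIV. \<Gamma> d a c p * g p $ b $ d) = 0"
    using assms unfolding levi_civita_on_def by blast
  then show ?thesis
    by (simp add: sum_2)
qed

lemma levi_civita_on_sym: "levi_civita_on U g \<Gamma> \<Longrightarrow> p \<in> U \<Longrightarrow> \<Gamma> c b a p = \<Gamma> c a b p"
  unfolding levi_civita_on_def by blast

text \<open>The symbols are given only by symmetry and metricity, so their class has to be recovered
  from the metric: Koszul's formula expresses them through its first derivatives.\<close>

lemma Ck_on_levi_civita:
  assumes U: "open U" and met: "metric_on U g" and lc: "levi_civita_on U g \<Gamma>"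
  shows "Ck_on 1 U (\<Gamma> c a b)"
proof -
  \<comment> \<open>Christoffel symbols of the first kind.\<close>
  let ?S = "\<lambda>a b k p. 1/2 * (\<partial> a (\<lambda>q. g q $ b $ k) p + \<partial> b (\<lambda>q. g q $ a $ k) p - \<partial> k (\<lambda>q. g q $ a $ b) p)"
  let ?\<Delta> = "\<lambda>p. g p $ 1 $ 1 * g p $ 2 $ 2 - g p $ 1 $ 2 * g p $ 1 $ 2"
  have S: "?S a b k p = \<Gamma> 1 a b p * g p $ 1 $ k + \<Gamma> 2 a b p * g p $ 2 $ k" if p: "p \<in> U" for k p
    using levi_civita_on_sym[OF lc p, of _ b a] levi_civita_on_sym[OF lc p, of _ k a] levi_civita_on_sym[OF lc p, of _ k b]
      metric_on_sym[OF met p, of b 1] metric_on_sym[OF met p, of b 2] metric_on_sym[OF met p, of a 1] metric_on_sym[OF met p, of a 2]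
    unfolding levi_civita_on_pd[OF lc p] by (simp add: algebra_simps)
  have nz: "?\<Delta> p \<noteq> 0" if "p \<in> U" for p
    using met metric_on_det[OF met that] that by (auto simp: metric_on_def)
  have g: "Ck_on (Suc 1) U (\<lambda>p. g p $ a $ b)" for a b
    using met by (simp add: metric_on_def numeral_2_eq_2)
  note Ck = g[THEN Ck_on_SucD] g[THEN Ck_on_pd]
  \<comment> \<open>For fixed a and b, \<open>S\<close> is a linear 2 x 2 system for the two
    symbols; Cramer's rule solves it.\<close>
  have "Ck_on 1 U (\<Gamma> 1 a b)"
  proof (rule Ck_on_cong[OF U])
    show "Ck_on 1 U (\<lambda>p. (?S a b 1 p * g p $ 2 $ 2 - ?S a b 2 p * g p $ 1 $ 2) * inverse (?\<Delta> p))"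
      using nz by (intro Ck_intros U Ck)
    show "(?S a b 1 p * g p $ 2 $ 2 - ?S a b 2 p * g p $ 1 $ 2) * inverse (?\<Delta> p) = \<Gamma> 1 a b p" if "p \<in> U" for p
      using nz[OF that] metric_on_sym[OF met that, of 2 1] unfolding S[OF that] by (simp add: field_simps)
  qed
  moreover have "Ck_on 1 U (\<Gamma> 2 a b)"
  proof (rule Ck_on_cong[OF U])
    show "Ck_on 1 U (\<lambda>p. (?S a b 2 p * g p $ 1 $ 1 - ?S a b 1 p * g p $ 1 $ 2) * inverse (?\<Delta> p))"
      using nz by (intro Ck_intros U Ck)
    show "(?S a b 2 p * g p $ 1 $ 1 - ?S a b 1 p * g p $ 1 $ 2) * inverse (?\<Delta> p) = \<Gamma> 2 a b p" if "p \<in> U" for p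
      using nz[OF that] metric_on_sym[OF met that, of 2 1] unfolding S[OF that] by (simp add: field_simps)
  qed
  ultimately show ?thesis
    using exhaust_2[of c] by auto
qed

text \<open>The factor \<open>w\<close> is \<open>\<bar>det g\<bar> powr (- 2/3)\<close>; the square makes the base positive and smooth for
  either sign of the determinant.\<close>

lemma liouville_system_metric:
  assumes U: "open U" and met: "metric_on U g" and lc: "levi_civita_on U g \<Gamma>"
    and C5: "Ck_on 5 U A0" "Ck_on 5 U A1" "Ck_on 5 U A2" "Ck_on 5 U A3"
    and A: "\<And>p. p \<in> U \<Longrightarrow> A0 p = - \<Gamma> 2 1 1 p" "\<And>p. p \<in> U \<Longrightarrow> A1 p = \<Gamma> 1 1 1 p - 2 * \<Gamma> 2 1 2 p"
      "\<And>p. p \<in> U \<Longrightarrow> A2 p = 2 * \<Gamma> 1 1 2 p - \<Gamma> 2 2 2 p" "\<And>p. p \<in> U \<Longrightarrow> A3 p = \<Gamma> 1 2 2 p"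
  defines "w \<equiv> \<lambda>p. (det (g p))\<^sup>2 powr (- 1/3)"
  shows "liouville_system A0 A1 A2 A3 U (\<lambda>p. w p * g p $ 1 $ 1) (\<lambda>p. w p * g p $ 1 $ 2) (\<lambda>p. w p * g p $ 2 $ 2)"
proof -
  define E F G where "E = (\<lambda>p. g p $ 1 $ 1)" and "F = (\<lambda>p. g p $ 1 $ 2)" and "G = (\<lambda>p. g p $ 2 $ 2)"
  define \<Delta> where "\<Delta> = (\<lambda>p. E p * G p - F p * F p)"
  have sym: "g p $ 2 $ 1 = F p" if "p \<in> U" for p
    using metric_on_sym[OF met that] by (simp add: F_def)
  have det: "det (g p) = \<Delta> p" if "p \<in> U" for p
    using metric_on_det[OF met that] by (simp add: \<Delta>_def E_def F_def G_def)
  have nz: "\<Delta> p \<noteq> 0" if "p \<in> U" for p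
    using met that det[OF that] by (auto simp: metric_on_def)
  have C2: "Ck_on 2 U E" "Ck_on 2 U F" "Ck_on 2 U G"
    using met unfolding metric_on_def E_def F_def G_def by blast+
  then have C2\<Delta>: "Ck_on 2 U \<Delta>"
    unfolding \<Delta>_def by (intro Ck_intros U)
  have C2w: "Ck_on 2 U w"
  proof (rule Ck_on_cong[OF U])
    show "Ck_on 2 U (\<lambda>p. (\<Delta> p)\<^sup>2 powr (- 1/3))"
      using nz by (intro Ck_intros U C2\<Delta>) auto
  qed (simp add: w_def det)
  have pd: "pdiff a f p" if "Ck_on 2 U f" "p \<in> U" for a f p
    using Ck_on_has_pd[OF U, of 1 f p a] that unfolding pdiff_def by (auto simp: numeral_2_eq_2)
  note pds = C2[THEN pd] C2\<Delta>[THEN pd] C2w[THEN pd]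
  have Gsym: "\<Gamma> c 2 1 p = \<Gamma> c 1 2 p" if "p \<in> U" for c p
    using lc that by (rule levi_civita_on_sym)
  note lc' = levi_civita_on_pd[OF lc]
  have dE: "\<partial> a E p = 2 * (\<Gamma> 1 a 1 p * E p + \<Gamma> 2 a 1 p * F p)"
    and dF: "\<partial> a F p = \<Gamma> 1 a 1 p * F p + \<Gamma> 2 a 1 p * G p + \<Gamma> 1 a 2 p * E p + \<Gamma> 2 a 2 p * F p"
    and dG: "\<partial> a G p = 2 * (\<Gamma> 1 a 2 p * F p + \<Gamma> 2 a 2 p * G p)" if "p \<in> U" for a p
    using lc'[OF that, of a 1 1] lc'[OF that, of a 1 2] lc'[OF that, of a 2 2] sym[OF that]
    by (simp_all add: E_def F_def G_def)
  \<comment> \<open>Jacobi's formula: the logarithmic derivative of the determinant is twice the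
    trace of the connection.\<close>
  have d\<Delta>: "\<partial> a \<Delta> p = 2 * \<Delta> p * (\<Gamma> 1 a 1 p + \<Gamma> 2 a 2 p)" if "p \<in> U" for a p
  proof -
    have "\<partial> a \<Delta> p = \<partial> a E p * G p + E p * \<partial> a G p - (\<partial> a F p * F p + F p * \<partial> a F p)"
      using that unfolding \<Delta>_def by (simp add: pd_simps pds)
    then show ?thesis
      unfolding dE[OF that] dF[OF that] dG[OF that] by (simp add: \<Delta>_def algebra_simps)
  qed
  \<comment> \<open>The factor -4/3 is 2 * 2 * (- 1/3): the square, Jacobi's formula and the
    exponent. Passing to the trace-free symbols contributes trace terms of total weight 4/3 to the
    symmetrised derivative of the metric, and these are cancelled.\<close>
  have dw: "\<partial> a w p = - 4/3 * w p * (\<Gamma> 1 a 1 p + \<Gamma> 2 a 2 p)" if p: "p \<in> U" for a p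
  proof -
    have "has_pd a (\<lambda>q. (\<Delta> q)\<^sup>2) (2 * \<Delta> p * \<partial> a \<Delta> p) p"
      using p by (simp add: has_pd_iff pd_simps pds)
    then have "has_pd a (\<lambda>q. (\<Delta> q)\<^sup>2 powr (- 1/3))
        (- 1/3 * (\<Delta> p)\<^sup>2 powr (- 1/3) * (2 * \<Delta> p * \<partial> a \<Delta> p) * inverse ((\<Delta> p)\<^sup>2)) p"
      using nz[OF p] by (intro has_pd_powr) auto
    then have "has_pd a w (- 1/3 * (\<Delta> p)\<^sup>2 powr (- 1/3) * (2 * \<Delta> p * \<partial> a \<Delta> p) * inverse ((\<Delta> p)\<^sup>2)) p"
      by (rule has_pd_cong[OF _ U p]) (simp add: w_def det)
    then have "\<partial> a w p = - 1/3 * w p * (2 * \<Delta> p * \<partial> a \<Delta> p) * inverse ((\<Delta> p)\<^sup>2)"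
      using det[OF p] by (simp add: has_pd_iff w_def)
    also have "\<dots> = - 4/3 * w p * (\<Gamma> 1 a 1 p + \<Gamma> 2 a 2 p) * (\<Delta> p * \<Delta> p * inverse ((\<Delta> p)\<^sup>2))"
      unfolding d\<Delta>[OF p] by (simp add: algebra_simps)
    also have "\<Delta> p * \<Delta> p * inverse ((\<Delta> p)\<^sup>2) = 1"
      using nz[OF p] by (simp add: field_simps power2_eq_square)
    finally show ?thesis
      by simp
  qed
  have dz: "\<partial> a (\<lambda>q. w q * f q) p = \<partial> a w p * f p + w p * \<partial> a f p" if "Ck_on 2 U f" "p \<in> U" for f a p
    using that pds pd by (simp add: pd_simps)
  note eqs = dz dw dE dF dG A Gsym C2
  have "liouville_system A0 A1 A2 A3 U (\<lambda>p. w p * E p) (\<lambda>p. w p * F p) (\<lambda>p. w p * G p)"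
  proof
    show "open U"
      by (fact U)
    show "Ck_on 5 U A0" "Ck_on 5 U A1" "Ck_on 5 U A2" "Ck_on 5 U A3"
      by (fact C5)+
    show "Ck_on 2 U (\<lambda>p. w p * E p)" "Ck_on 2 U (\<lambda>p. w p * F p)" "Ck_on 2 U (\<lambda>p. w p * G p)"
      by (intro Ck_intros U C2w C2)+
    fix p assume p: "p \<in> U"
    \<comment> \<open>The four equations are the components 111, 112, 122 and 222 of the symmetrised
      covariant derivative.\<close>
    show "\<partial> 1 (\<lambda>p. w p * E p) p = 2/3 * A1 p * (w p * E p) - 2 * A0 p * (w p * F p)"
      using p by (simp add: eqs, simp add: field_simps)
    show "\<partial> 2 (\<lambda>p. w p * E p) p = 4/3 * A2 p * (w p * E p) - 2/3 * A1 p * (w p * F p)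
        - 2 * A0 p * (w p * G p) - 2 * \<partial> 1 (\<lambda>p. w p * F p) p"
      using p by (simp add: eqs, simp add: field_simps)
    show "\<partial> 1 (\<lambda>p. w p * G p) p = 2 * A3 p * (w p * E p) + 2/3 * A2 p * (w p * F p)
        - 4/3 * A1 p * (w p * G p) - 2 * \<partial> 2 (\<lambda>p. w p * F p) p"
      using p by (simp add: eqs, simp add: field_simps)
    show "\<partial> 2 (\<lambda>p. w p * G p) p = 2 * A3 p * (w p * F p) - 2/3 * A2 p * (w p * G p)"
      using p by (simp add: eqs, simp add: field_simps)
  qed
  then show ?thesis
    by (simp add: E_def F_def G_def)
qed

lemma det_M_metric:
  assumes "open U" "metric_on U g" "levi_civita_on U g \<Gamma>"
    and "Ck_on 5 U A0" "Ck_on 5 U A1" "Ck_on 5 U A2" "Ck_on 5 U A3"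
    and "\<And>p. p \<in> U \<Longrightarrow> A0 p = - \<Gamma> 2 1 1 p" "\<And>p. p \<in> U \<Longrightarrow> A1 p = \<Gamma> 1 1 1 p - 2 * \<Gamma> 2 1 2 p"
      "\<And>p. p \<in> U \<Longrightarrow> A2 p = 2 * \<Gamma> 1 1 2 p - \<Gamma> 2 2 2 p" "\<And>p. p \<in> U \<Longrightarrow> A3 p = \<Gamma> 1 2 2 p"
    and p: "p \<in> U"
  shows "det (cubic_ode.M A0 A1 A2 A3 p) = 0"
proof -
  note sys = liouville_system_metric[OF assms(1-11)]
  have nz: "det (g p) \<noteq> 0"
    using assms(2) p by (auto simp: metric_on_def)
  then have "g p $ 1 $ 1 \<noteq> 0 \<or> g p $ 1 $ 2 \<noteq> 0 \<or> g p $ 2 $ 2 \<noteq> 0"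
    using metric_on_det[OF assms(2) p] by auto
  then show ?thesis
    using nz by (intro liouville_system.det_M[OF sys p]) auto
qed

section \<open>Local existence of geodesics\<close>

text \<open>Picard iteration as a contraction on the complete space of bounded continuous functions
  on the whole line; clamping time to \<open>{a..b}\<close> keeps the iterates bounded.\<close>

lemma picard_lipschitz:
  fixes G :: "real \<Rightarrow> 'a::banach \<Rightarrow> 'a"
  assumes cont: "continuous_on UNIV (\<lambda>x. G (fst x) (snd x))"
    and lip: "\<And>t z z'. dist (G t z) (G t z') \<le> L * dist z z'"
  shows "\<exists>h \<phi>. 0 < h \<and> \<phi> t0 = z0 \<and>
    (\<forall>t. \<bar>t - t0\<bar> < h \<longrightarrow> (\<phi> has_vector_derivative G t (\<phi> t)) (at t))"
proof -
  \<comment> \<open>Two integrals over length at most 2 * h contribute 4 * h * |L|, so 8 * h * |L|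
    \<le> 1 gives contraction factor 1/2. Adding 1 covers L = 0.\<close>
  define h where "h = 1 / (8 * (\<bar>L\<bar> + 1))"
  have "h > 0"
    by (simp add: h_def)
  have hL: "8 * (h * \<bar>L\<bar>) \<le> 1"
    by (simp add: h_def divide_simps)
  define a b where "a = t0 - h" and "b = t0 + h"
  define cl where "cl = (\<lambda>t::real. max a (min b t))"
  have ab: "a < b" "t0 \<in> {a..b}"
    using \<open>h > 0\<close> by (auto simp: a_def b_def)
  have cl: "cl t \<in> {a..b}" for t
    using ab by (auto simp: cl_def)
  have cl_id: "cl t = t" if "t \<in> {a..b}" for t
    using that by (auto simp: cl_def)
  \<comment> \<open>A difference of two integrals from \<open>a\<close> stands for the oriented
    integral from \<open>t0\<close>, which also has to cover times before \<open>t0\<close>.\<close>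
  define J where "J = (\<lambda>f::real \<Rightarrow> 'a. \<lambda>t. z0 + (integral {a..cl t} f - integral {a..t0} f))"
  define T where "T = (\<lambda>\<phi>::real \<Rightarrow>\<^sub>C 'a. Bcontfun (J (\<lambda>t. G t (\<phi> t))))"
  have contG: "continuous_on S (\<lambda>t. G t (apply_bcontfun \<phi> t))" for S \<phi>
  proof -
    have "continuous_on S (\<lambda>t. (t, apply_bcontfun \<phi> t))"
      by (intro continuous_intros) simp
    from continuous_on_compose2[OF cont this] show ?thesis
      by simp
  qed
  have J_in: "J f \<in> bcontfun" if "continuous_on {a..b} f" for f
  proof -
    have c: "continuous_on {a..b} (\<lambda>t. integral {a..t} f)"
      using that by (intro indefinite_integral_continuous_1 integrable_continuous_real)
    have "continuous_on UNIV (J f)"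
      unfolding J_def using cl
      by (intro continuous_intros continuous_on_compose2[OF c]) (auto simp: cl_def intro!: continuous_intros)
    moreover have "bounded (range (\<lambda>t. integral {a..cl t} f))"
      by (rule bounded_subset[OF compact_imp_bounded[OF compact_continuous_image[OF c compact_Icc]]])
        (use cl in auto)
    then obtain B where "\<And>t. norm (integral {a..cl t} f) \<le> B"
      unfolding bounded_iff by auto
    then have "norm (J f t) \<le> norm z0 + (B + norm (integral {a..t0} f))" for t
      unfolding J_def by (intro order_trans[OF norm_triangle_ineq] add_mono order_refl order_trans[OF norm_triangle_ineq4]) auto
    ultimately show ?thesis
      by (rule bcontfun_normI)
  qed
  have T_apply: "apply_bcontfun (T \<phi>) = J (\<lambda>t. G t (\<phi> t))" for \<phi>
    unfolding T_def by (rule Bcontfun_inverse[OF J_in[OF contG]])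
  have "dist (T \<phi>) (T \<psi>) \<le> 1/2 * dist \<phi> \<psi>" for \<phi> \<psi>
  proof (rule dist_bound)
    fix t
    let ?f = "\<lambda>t. G t (\<phi> t) - G t (\<psi> t)"
    have int: "norm (integral {a..s} ?f) \<le> \<bar>L\<bar> * dist \<phi> \<psi> * (2 * h)" if "s \<in> {a..b}" for s
    proof -
      have "norm (?f u) \<le> \<bar>L\<bar> * dist \<phi> \<psi>" for u
      proof -
        have "norm (?f u) \<le> L * dist (\<phi> u) (\<psi> u)"
          using lip[of u "\<phi> u" "\<psi> u"] by (simp add: dist_norm)
        also have "\<dots> \<le> \<bar>L\<bar> * dist (\<phi> u) (\<psi> u)"
          by (intro mult_right_mono) auto
        also have "\<dots> \<le> \<bar>L\<bar> * dist \<phi> \<psi>"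
          by (intro mult_left_mono dist_bounded) auto
        finally show ?thesis .
      qed
      then have "norm (integral {a..s} ?f) \<le> \<bar>L\<bar> * dist \<phi> \<psi> * (s - a)"
        using that by (intro integral_bound continuous_intros contG) auto
      also have "\<dots> \<le> \<bar>L\<bar> * dist \<phi> \<psi> * (2 * h)"
        using that by (intro mult_left_mono) (auto simp: a_def b_def)
      finally show ?thesis .
    qed
    have diff: "integral {a..s} (\<lambda>t. G t (\<phi> t)) - integral {a..s} (\<lambda>t. G t (\<psi> t)) = integral {a..s} ?f" for s
      by (intro integral_diff[symmetric] integrable_continuous_real contG)
    have "dist (T \<phi> t) (T \<psi> t) = norm (integral {a..cl t} ?f - integral {a..t0} ?f)"
      unfolding T_apply J_def dist_norm diff[symmetric] by (simp add: algebra_simps)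
    also have "\<dots> \<le> \<bar>L\<bar> * dist \<phi> \<psi> * (2 * h) + \<bar>L\<bar> * dist \<phi> \<psi> * (2 * h)"
      by (intro order_trans[OF norm_triangle_ineq4] add_mono int cl ab)
    also have "\<dots> = (8 * (h * \<bar>L\<bar>)) * (1/2 * dist \<phi> \<psi>)"
      by simp
    also have "\<dots> \<le> 1 * (1/2 * dist \<phi> \<psi>)"
      using hL by (intro mult_right_mono) auto
    finally show "dist (T \<phi> t) (T \<psi> t) \<le> 1/2 * dist \<phi> \<psi>"
      by simp
  qed
  then obtain \<phi> where "T \<phi> = \<phi>"
    using banach_fix_type[of "1/2" T] by auto
  then have \<phi>: "apply_bcontfun \<phi> = J (\<lambda>t. G t (\<phi> t))"
    using T_apply by metis
  show ?thesis
  proof (intro exI[of _ h] exI[of _ "apply_bcontfun \<phi>"] conjI[OF \<open>h > 0\<close> conjI] allI impI)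
    show "\<phi> t0 = z0"
      using fun_cong[OF \<phi>, of t0] ab by (simp add: J_def cl_id)
    fix t assume "\<bar>t - t0\<bar> < h"
    then have t: "t \<in> {a<..<b}"
      by (auto simp: a_def b_def)
    have \<phi>_eq: "\<phi> u = z0 + (integral {a..u} (\<lambda>t. G t (\<phi> t)) - integral {a..t0} (\<lambda>t. G t (\<phi> t)))"
      if "u \<in> {a<..<b}" for u
      using fun_cong[OF \<phi>, of u] that by (simp add: J_def cl_id)
    have "((\<lambda>u. integral {a..u} (\<lambda>t. G t (\<phi> t))) has_vector_derivative G t (\<phi> t)) (at t within {a..b})"
      using t by (intro integral_has_vector_derivative contG) auto
    then have "((\<lambda>u. integral {a..u} (\<lambda>t. G t (\<phi> t))) has_vector_derivative G t (\<phi> t)) (at t)"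
      using t by (simp add: at_within_Icc_at)
    then have "((\<lambda>u. z0 + (integral {a..u} (\<lambda>t. G t (\<phi> t)) - integral {a..t0} (\<lambda>t. G t (\<phi> t)))) has_vector_derivative
        G t (\<phi> t)) (at t)"
      by (auto intro!: derivative_eq_intros)
    then show "(apply_bcontfun \<phi> has_vector_derivative G t (\<phi> t)) (at t)"
      by (rule has_vector_derivative_transform_within_open[OF _ open_greaterThanLessThan t])
         (simp add: \<phi>_eq[symmetric])
  qed
qed

text \<open>Composing with the clamp in time and the closest point projection onto the ball gives a
  globally Lipschitz field, as projection onto a closed convex set does not increase distances. By
  continuity the solution stays in the ball for a short time, where both fields agree.\<close>

lemma picard_local:
  fixes G :: "real \<Rightarrow> 'a::euclidean_space \<Rightarrow> 'a"
  assumes "d > 0" and r: "r > 0"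
    and cont: "continuous_on ({t0-d..t0+d} \<times> cball z0 r) (\<lambda>x. G (fst x) (snd x))"
    and lip: "\<And>t z z'. t \<in> {t0-d..t0+d} \<Longrightarrow> z \<in> cball z0 r \<Longrightarrow> z' \<in> cball z0 r \<Longrightarrow>
        dist (G t z) (G t z') \<le> L * dist z z'"
  shows "\<exists>h \<phi>. 0 < h \<and> h \<le> d \<and> \<phi> t0 = z0 \<and>
    (\<forall>t. \<bar>t - t0\<bar> < h \<longrightarrow> \<phi> t \<in> cball z0 r \<and> (\<phi> has_vector_derivative G t (\<phi> t)) (at t))"
proof -
  let ?K = "cball z0 r"
  define cl where "cl = (\<lambda>t::real. max (t0-d) (min (t0+d) t))"
  define H where "H = (\<lambda>t z. G (cl t) (closest_point ?K z))"
  have K: "closest_point ?K z \<in> ?K" for z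
    using r by (intro closest_point_in_set) auto
  have cl: "cl t \<in> {t0-d..t0+d}" for t
    using \<open>d > 0\<close> by (auto simp: cl_def)
  have 1: "continuous_on UNIV (\<lambda>x. H (fst x) (snd x))"
  proof -
    have "continuous_on UNIV (\<lambda>x. closest_point ?K (snd x :: 'a))"
      using r by (intro continuous_on_compose2[OF continuous_on_closest_point continuous_on_snd[OF continuous_on_id]]) auto
    then have "continuous_on UNIV (\<lambda>x. (cl (fst x), closest_point ?K (snd x)))"
      unfolding cl_def by (intro continuous_intros)
    moreover have "(\<lambda>x. (cl (fst x), closest_point ?K (snd x))) ` UNIV \<subseteq> {t0-d..t0+d} \<times> ?K"
      by (intro image_subsetI SigmaI cl K)
    ultimately have "continuous_on UNIV (\<lambda>x. (\<lambda>x. G (fst x) (snd x)) (cl (fst x), closest_point ?K (snd x)))"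
      by (rule continuous_on_compose2[OF cont])
    then show ?thesis
      by (simp add: H_def)
  qed
  have 2: "dist (H t z) (H t z') \<le> \<bar>L\<bar> * dist z z'" for t z z'
  proof -
    have "dist (H t z) (H t z') \<le> L * dist (closest_point ?K z) (closest_point ?K z')"
      unfolding H_def by (intro lip cl K)
    also have "\<dots> \<le> \<bar>L\<bar> * dist (closest_point ?K z) (closest_point ?K z')"
      by (intro mult_right_mono) auto
    also have "\<dots> \<le> \<bar>L\<bar> * dist z z'"
      using r by (intro mult_left_mono closest_point_lipschitz) auto
    finally show ?thesis .
  qed
  obtain h \<phi> where \<phi>: "h > 0" "\<phi> t0 = z0"
      "\<And>t. \<bar>t - t0\<bar> < h \<Longrightarrow> (\<phi> has_vector_derivative H t (\<phi> t)) (at t)"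
    using picard_lipschitz[OF 1 2, of t0 z0] by blast
  have "isCont \<phi> t0"
    using \<phi>(3)[of t0] \<phi>(1) by (intro has_vector_derivative_continuous) auto
  then obtain e where e: "e > 0" "\<And>t. dist t t0 < e \<Longrightarrow> dist (\<phi> t) (\<phi> t0) < r"
    using r unfolding continuous_at_eps_delta by blast
  show ?thesis
  proof (intro exI[of _ "min (min h e) d"] exI[of _ \<phi>] conjI[OF _ conjI[OF _ conjI]] allI impI)
    fix t assume t: "\<bar>t - t0\<bar> < min (min h e) d"
    then have "\<phi> t \<in> ?K"
      using e(2)[of t] \<phi>(2) by (auto simp: dist_real_def dist_commute)
    moreover from this have "H t (\<phi> t) = G t (\<phi> t)"
      using t by (auto simp: H_def cl_def closest_point_self)
    ultimately show "\<phi> t \<in> ?K \<and> (\<phi> has_vector_derivative G t (\<phi> t)) (at t)"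
      using \<phi>(3)[of t] t by auto
  qed (use \<phi> e \<open>d > 0\<close> in auto)
qed

section \<open>The cubic equation as a first order system\<close>

lemma vector_2_axis: "(vector [a, b] :: real^2) = a *\<^sub>R axis 1 1 + b *\<^sub>R axis 2 1"
  by (simp add: vec_eq_iff forall_2 axis_def)

lemma has_derivative_along_y:
  assumes "f differentiable (at (vector [t, fst z]))"
  shows "((\<lambda>z. f (vector [t, fst z])) has_derivative (\<lambda>h. \<partial> 2 f (vector [t, fst z]) * fst h)) (at (z :: real \<times> real))"
proof -
  have "(f has_derivative (\<lambda>v. \<partial> 1 f (vector [t, fst z]) * v $ 1 + \<partial> 2 f (vector [t, fst z]) * v $ 2)) (at (vector [t, fst z]))"
    using assms by (rule has_derivative_pd)
  moreover have "((\<lambda>z. vector [t, fst z] :: real^2) has_derivative (\<lambda>h. fst h *\<^sub>R axis 2 1)) (at z)"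
    unfolding vector_2_axis by (auto intro!: derivative_eq_intros)
  ultimately have "((\<lambda>z. f (vector [t, fst z])) has_derivative
      (\<lambda>h. \<partial> 1 f (vector [t, fst z]) * (fst h *\<^sub>R axis 2 1 :: real^2) $ 1 + \<partial> 2 f (vector [t, fst z]) * (fst h *\<^sub>R axis 2 1 :: real^2) $ 2)) (at z)"
    by (rule has_derivative_compose[rotated])
  then show ?thesis
    by (simp add: axis_def)
qed

text \<open>The system for z = (y, slope) is Lipschitz in z on a compact cylinder, because the
  partial derivatives \<open>Fy\<close> and \<open>Fs\<close> of the cubic are continuous and hence
  bounded there.\<close>

lemma cubic_ode_local_solution:
  assumes U: "open U" "vector [x0, y0] \<in> U"
    and C1: "Ck_on 1 U A0" "Ck_on 1 U A1" "Ck_on 1 U A2" "Ck_on 1 U A3"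
  obtains h y y' where "h > 0" "y x0 = y0" "y' x0 = s0"
    "\<And>x. \<bar>x - x0\<bar> < h \<Longrightarrow> vector [x, y x] \<in> U \<and> (y has_real_derivative y' x) (at x) \<and>
      (y' has_real_derivative A3 (vector [x, y x]) * y' x ^ 3 + A2 (vector [x, y x]) * y' x ^ 2
        + A1 (vector [x, y x]) * y' x + A0 (vector [x, y x])) (at x)"
proof -
  obtain e where e: "e > 0" "ball (vector [x0, y0]) e \<subseteq> U"
    using U open_contains_ball by blast
  \<comment> \<open>Offsets of at most d in x and in y move the point by at most 2 * d < e.\<close>
  define d where "d = e / 3"
  have "d > 0"
    using e by (simp add: d_def)
  define K where "K = cball (y0, s0) d"
  define P where "P = {x0-d..x0+d} \<times> K"
  have inU: "vector [t, fst z] \<in> U" if "t \<in> {x0-d..x0+d}" "z \<in> K" for t z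
  proof -
    have "\<bar>y0 - fst z\<bar> \<le> d"
      using that(2) dist_fst_le[of "(y0, s0)" z] by (simp add: K_def dist_real_def)
    moreover have "\<bar>x0 - t\<bar> \<le> d"
      using that(1) by auto
    moreover have "dist (vector [x0, y0] :: real^2) (vector [t, fst z]) \<le> \<bar>x0 - t\<bar> + \<bar>y0 - fst z\<bar>"
      using norm_le_l1_cart[of "vector [x0, y0] - vector [t, fst z] :: real^2"] by (simp add: dist_norm sum_2)
    ultimately have "dist (vector [x0, y0] :: real^2) (vector [t, fst z]) < e"
      using e(1) by (simp add: d_def)
    then show ?thesis
      using e(2) by auto
  qed
  have "compact P"
    unfolding P_def K_def by (intro compact_Times compact_Icc compact_cball)
  let ?v = "\<lambda>x::real \<times> real \<times> real. vector [fst x, fst (snd x)] :: real^2" and ?s = "\<lambda>x::real \<times> real \<times> real. snd (snd x)"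
  have v: "continuous_on P ?v"
    unfolding vector_2_axis by (intro continuous_intros)
  have vU: "?v ` P \<subseteq> U"
    using inU by (auto simp: P_def)
  have contA: "continuous_on P (\<lambda>x. f (?v x))" if "continuous_on U f" for f :: "real^2 \<Rightarrow> real"
    using that v vU by (rule continuous_on_compose2)
  have C1': "continuous_on U (\<partial> 2 A0)" "continuous_on U (\<partial> 2 A1)" "continuous_on U (\<partial> 2 A2)" "continuous_on U (\<partial> 2 A3)"
    using C1 by simp_all
  note cont = C1[THEN Ck_on_imp_continuous, THEN contA] C1'[THEN contA]
  define F where "F = (\<lambda>t z. A3 (vector [t, fst z]) * snd z ^ 3 + A2 (vector [t, fst z]) * snd z ^ 2
        + A1 (vector [t, fst z]) * snd z + A0 (vector [t, fst z]) :: real)"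
  define Fy where "Fy = (\<lambda>x. \<partial> 2 A3 (?v x) * ?s x ^ 3 + \<partial> 2 A2 (?v x) * ?s x ^ 2 + \<partial> 2 A1 (?v x) * ?s x + \<partial> 2 A0 (?v x))"
  define Fs where "Fs = (\<lambda>x. A3 (?v x) * (3 * ?s x ^ 2) + A2 (?v x) * (2 * ?s x) + A1 (?v x))"
  have contF: "continuous_on P (\<lambda>x. F (fst x) (snd x))"
    unfolding F_def by (intro continuous_intros cont)
  have "continuous_on P Fy" "continuous_on P Fs"
    unfolding Fy_def Fs_def by (intro continuous_intros cont)+
  then have "bounded (Fy ` P)" "bounded (Fs ` P)"
    using \<open>compact P\<close> compact_continuous_image compact_imp_bounded by blast+
  then obtain B1 B2 where B: "\<And>x. x \<in> P \<Longrightarrow> \<bar>Fy x\<bar> \<le> B1" "\<And>x. x \<in> P \<Longrightarrow> \<bar>Fs x\<bar> \<le> B2"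
    unfolding bounded_iff by auto
  have lipF: "\<bar>F t z - F t z'\<bar> \<le> (B1 + B2) * dist z z'"
    if t: "t \<in> {x0-d..x0+d}" and z: "z \<in> K" "z' \<in> K" for t z z'
  proof -
    have "norm (F t z - F t z') \<le> (B1 + B2) * norm (z - z')"
    proof (rule differentiable_bound[of K _ "\<lambda>z h. Fy (t, z) * fst h + Fs (t, z) * snd h"])
      fix u assume u: "u \<in> K"
      have diff: "f differentiable (at (vector [t, fst u]))" if "Ck_on 1 U f" for f
        using Ck_on_imp_differentiable[OF U(1), of 0 f] that inU[OF t u] by auto
      show "(F t has_derivative (\<lambda>h. Fy (t, u) * fst h + Fs (t, u) * snd h)) (at u within K)"
        unfolding F_def
        by (rule has_derivative_at_withinI)
           (auto intro!: derivative_eq_intros C1[THEN diff, THEN has_derivative_along_y]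
             simp: Fy_def Fs_def algebra_simps power2_eq_square)
      have "(t, u) \<in> P"
        using t u by (simp add: P_def)
      show "onorm (\<lambda>h. Fy (t, u) * fst h + Fs (t, u) * snd h) \<le> B1 + B2"
      proof (rule onorm_le)
        fix h :: "real \<times> real"
        have "\<bar>fst h\<bar> \<le> norm h" "\<bar>snd h\<bar> \<le> norm h"
          using norm_fst_le[of "fst h" "snd h"] norm_snd_le[of "snd h" "fst h"] by simp_all
        then have "\<bar>Fy (t, u) * fst h\<bar> + \<bar>Fs (t, u) * snd h\<bar> \<le> B1 * norm h + B2 * norm h"
          unfolding abs_mult using B[OF \<open>(t, u) \<in> P\<close>] by (intro add_mono mult_mono) auto
        then show "norm (Fy (t, u) * fst h + Fs (t, u) * snd h) \<le> (B1 + B2) * norm h"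
          by (simp add: distrib_right)
      qed
    qed (use z in \<open>auto simp: K_def\<close>)
    then show ?thesis
      by (simp add: dist_norm)
  qed
  define G where "G = (\<lambda>t z. (snd z, F t z))"
  have contG: "continuous_on ({x0-d..x0+d} \<times> cball (y0, s0) d) (\<lambda>x. G (fst x) (snd x))"
    using contF unfolding P_def K_def G_def by (intro continuous_intros)
  have lipG: "dist (G t z) (G t z') \<le> (1 + (B1 + B2)) * dist z z'"
    if "t \<in> {x0-d..x0+d}" "z \<in> cball (y0, s0) d" "z' \<in> cball (y0, s0) d" for t z z'
  proof -
    have "dist (G t z) (G t z') \<le> dist (snd z) (snd z') + \<bar>F t z - F t z'\<bar>"
      using norm_Pair_le[of "snd z - snd z'" "F t z - F t z'"] by (simp add: G_def dist_norm)
    also have "\<dots> \<le> dist z z' + (B1 + B2) * dist z z'"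
      using that by (intro add_mono dist_snd_le lipF) (auto simp: K_def)
    finally show ?thesis
      by (simp add: algebra_simps)
  qed
  obtain h \<phi> where h: "0 < h" "h \<le> d" "\<phi> x0 = (y0, s0)"
    and \<phi>: "\<And>t. \<bar>t - x0\<bar> < h \<Longrightarrow> \<phi> t \<in> cball (y0, s0) d \<and> (\<phi> has_vector_derivative G t (\<phi> t)) (at t)"
    using picard_local[OF \<open>d > 0\<close> \<open>d > 0\<close> contG lipG] by blast
  show ?thesis
  proof (rule that[of h "\<lambda>x. fst (\<phi> x)" "\<lambda>x. snd (\<phi> x)"])
    fix x assume x: "\<bar>x - x0\<bar> < h"
    have "((\<lambda>x. fst (\<phi> x)) has_vector_derivative fst (G x (\<phi> x))) (at x)"
      "((\<lambda>x. snd (\<phi> x)) has_vector_derivative snd (G x (\<phi> x))) (at x)"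
      using \<phi>[OF x] bounded_linear.has_vector_derivative[OF bounded_linear_fst]
        bounded_linear.has_vector_derivative[OF bounded_linear_snd] by blast+
    moreover have "vector [x, fst (\<phi> x)] \<in> U"
      using \<phi>[OF x] x h by (intro inU) (auto simp: K_def)
    ultimately show "vector [x, fst (\<phi> x)] \<in> U \<and> ((\<lambda>x. fst (\<phi> x)) has_real_derivative snd (\<phi> x)) (at x) \<and>
      ((\<lambda>x. snd (\<phi> x)) has_real_derivative A3 (vector [x, fst (\<phi> x)]) * snd (\<phi> x) ^ 3 + A2 (vector [x, fst (\<phi> x)]) * snd (\<phi> x) ^ 2
        + A1 (vector [x, fst (\<phi> x)]) * snd (\<phi> x) + A0 (vector [x, fst (\<phi> x)])) (at x)"
      by (simp add: has_real_derivative_iff_has_vector_derivative G_def F_def)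
  qed (use h in auto)
qed

section \<open>Comparison of the ODE with the geodesic equation\<close>

text \<open>Solve the cubic equation through p with slope s. The graph is a geodesic, hence by
  hypothesis an integral curve of \<Lambda>, and comparing the second derivatives at p gives the
  value of \<Lambda> there.\<close>

lemma geodesic_equation_cubic:
  assumes U: "open U" and met: "metric_on U g" and lc: "levi_civita_on U g \<Gamma>"
    and ode: "integral_curves_are_geodesics U \<Lambda> \<Gamma>" and p: "p \<in> U"
  shows "\<Lambda> p s = \<Gamma> 1 2 2 p * s^3 + (2 * \<Gamma> 1 1 2 p - \<Gamma> 2 2 2 p) * s^2
    + (\<Gamma> 1 1 1 p - 2 * \<Gamma> 2 1 2 p) * s + - \<Gamma> 2 1 1 p"
proof -
  define F where "F = (\<lambda>p s. \<Gamma> 1 2 2 p * s^3 + (2 * \<Gamma> 1 1 2 p - \<Gamma> 2 2 2 p) * s^2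
    + (\<Gamma> 1 1 1 p - 2 * \<Gamma> 2 1 2 p) * s + - \<Gamma> 2 1 1 p)"
  define x0 y0 where "x0 = p $ 1" and "y0 = p $ 2"
  have p_eq: "p = vector [x0, y0]"
    by (simp add: vec_eq_iff forall_2 x0_def y0_def)
  have p': "vector [x0, y0] \<in> U"
    using p p_eq by simp
  have C1: "Ck_on 1 U (\<Gamma> c a b)" for a b c
    using U met lc by (rule Ck_on_levi_civita)
  have "Ck_on 1 U (\<lambda>p. - \<Gamma> 2 1 1 p)" "Ck_on 1 U (\<lambda>p. \<Gamma> 1 1 1 p - 2 * \<Gamma> 2 1 2 p)"
    "Ck_on 1 U (\<lambda>p. 2 * \<Gamma> 1 1 2 p - \<Gamma> 2 2 2 p)" "Ck_on 1 U (\<lambda>p. \<Gamma> 1 2 2 p)"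
    by (intro Ck_intros U C1)+
  from cubic_ode_local_solution[OF U p' this, of s]
  obtain h y y' where h: "h > 0" "y x0 = y0" "y' x0 = s"
    and sol: "\<And>x. \<bar>x - x0\<bar> < h \<Longrightarrow> vector [x, y x] \<in> U \<and> (y has_real_derivative y' x) (at x) \<and>
      (y' has_real_derivative F (vector [x, y x]) (y' x)) (at x)"
    unfolding F_def by blast
  define I where "I = {x0 - h<..<x0 + h}"
  have I: "open I" "is_interval I" "x0 \<in> I"
    using h(1) by (auto simp: I_def is_interval_oo)
  have solI: "vector [x, y x] \<in> U" "(y has_real_derivative y' x) (at x)"
      "(y' has_real_derivative F (vector [x, y x]) (y' x)) (at x)" if "x \<in> I" for x
    using sol[of x] that by (auto simp: I_def abs_less_iff)
  have "unparametrised_geodesic U \<Gamma> I (\<lambda>x. vector [x, y x])"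
    unfolding unparametrised_geodesic_def
  proof (intro exI ballI conjI allI)
    fix x assume x: "x \<in> I"
    define q where "q = (vector [x, y x] :: real^2)"
    have q: "q \<in> U"
      using solI(1)[OF x] by (simp add: q_def)
    show "vector [x, y x] \<in> U"
      by (rule solI(1)[OF x])
    show "(vector [1, y' x] :: real^2) \<noteq> 0"
      by (simp add: vec_eq_iff forall_2)
    show "((\<lambda>x. vector [x, y x] :: real^2) has_vector_derivative vector [1, y' x]) (at x)"
      using solI(2)[OF x] unfolding vector_2_axis by (auto intro!: derivative_eq_intros)
    show "((\<lambda>x. vector [1, y' x] :: real^2) has_vector_derivative vector [0, F (vector [x, y x]) (y' x)]) (at x)"
      using solI(3)[OF x] unfolding vector_2_axis by (auto intro!: derivative_eq_intros)
    fix c :: 2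
    \<comment> \<open>With x as parameter the first component has no acceleration, so it determines
      the proportionality factor; inserting that factor into the second component produces the
      cubic.\<close>
    have "\<forall>c. (vector [0, F q (y' x)] :: real^2) $ c
        + (\<Sum>a\<in>UNIV. \<Sum>b\<in>UNIV. \<Gamma> c a b q * (vector [1, y' x] :: real^2) $ a * (vector [1, y' x] :: real^2) $ b)
      = (\<Gamma> 1 1 1 q + 2 * \<Gamma> 1 1 2 q * y' x + \<Gamma> 1 2 2 q * (y' x)^2) * (vector [1, y' x] :: real^2) $ c"
      using levi_civita_on_sym[OF lc q, of _ 2 1]
      by (simp add: forall_2 sum_2 F_def algebra_simps power2_eq_square power3_eq_cube)
    then show "(vector [0, F (vector [x, y x]) (y' x)] :: real^2) $ c
        + (\<Sum>a\<in>UNIV. \<Sum>b\<in>UNIV. \<Gamma> c a b (vector [x, y x]) * (vector [1, y' x] :: real^2) $ a * (vector [1, y' x] :: real^2) $ b)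
      = (\<Gamma> 1 1 1 (vector [x, y x]) + 2 * \<Gamma> 1 1 2 (vector [x, y x]) * y' x + \<Gamma> 1 2 2 (vector [x, y x]) * (y' x)^2)
        * (vector [1, y' x] :: real^2) $ c"
      unfolding q_def by blast
  qed
  then have "ode_solution U \<Lambda> I y"
    using ode I unfolding integral_curves_are_geodesics_def by blast
  then obtain u where u: "\<And>x. x \<in> I \<Longrightarrow> (y has_real_derivative u x) (at x) \<and>
      (u has_real_derivative \<Lambda> (vector [x, y x]) (u x)) (at x)"
    unfolding ode_solution_def by blast
  \<comment> \<open>The slope in \<open>ode_solution\<close> is an existential witness of its own;
    uniqueness of derivatives identifies it with \<open>y'\<close>.\<close>
  have uy: "u x = y' x" if "x \<in> I" for x
    using u[OF that] solI(2)[OF that] DERIV_unique by blast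
  then have "(y' has_real_derivative \<Lambda> (vector [x0, y x0]) (u x0)) (at x0)"
    using u[OF I(3)] I by (intro has_field_derivative_transform_within_open[of u _ x0 I y']) auto
  then have "\<Lambda> (vector [x0, y x0]) (u x0) = F (vector [x0, y x0]) (y' x0)"
    using solI(3)[OF I(3)] DERIV_unique by blast
  then show ?thesis
    using uy[OF I(3)] h p_eq by (simp add: F_def)
qed

text \<open>The values at the four points 0, 1, -1 and 2 determine a cubic. Thus any coefficients
  representing \<Lambda> are the combinations of Christoffel symbols to which
  \<open>det_M_metric\<close> applies.\<close>

lemma cubic_coeffs_unique:
  fixes a0 :: real
  assumes "\<And>s. a3 * s^3 + a2 * s^2 + a1 * s + a0 = b3 * s^3 + b2 * s^2 + b1 * s + b0"
  shows "a0 = b0" "a1 = b1" "a2 = b2" "a3 = b3"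
  using assms[of 0] assms[of 1] assms[of "-1"] assms[of 2] by (simp_all add: power2_eq_square power3_eq_cube)

theorem corollary1p2:
  fixes U :: "(real^2) set"
    and \<Lambda> :: "real^2 \<Rightarrow> real \<Rightarrow> real"
    and g :: "real^2 \<Rightarrow> real^2^2"
    and \<Gamma> :: connection
  assumes "open U"
    and "metric_on U g"
    and "levi_civita_on U g \<Gamma>"
    and "integral_curves_are_geodesics U \<Lambda> \<Gamma>"
  shows "(\<exists>A0 A1 A2 A3 :: real^2 \<Rightarrow> real. \<forall>p\<in>U. \<forall>s.
            \<Lambda> p s = A3 p * s^3 + A2 p * s^2 + A1 p * s + A0 p)
       \<and> (\<forall>A0 A1 A2 A3 :: real^2 \<Rightarrow> real.
            (\<forall>p\<in>U. \<forall>s. \<Lambda> p s = A3 p * s^3 + A2 p * s^2 + A1 p * s + A0 p) \<longrightarrow>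
            Ck_on 5 U A0 \<and> Ck_on 5 U A1 \<and> Ck_on 5 U A2 \<and> Ck_on 5 U A3 \<longrightarrow>
            (\<forall>p\<in>U. det (cubic_ode.M A0 A1 A2 A3 p) = 0))"
proof -
  note cubic = geodesic_equation_cubic[OF assms]
  show ?thesis
  proof (intro conjI allI impI ballI)
    show "\<exists>A0 A1 A2 A3 :: real^2 \<Rightarrow> real. \<forall>p\<in>U. \<forall>s.
        \<Lambda> p s = A3 p * s^3 + A2 p * s^2 + A1 p * s + A0 p"
      using cubic by (intro exI ballI allI)
  next
    fix A0 A1 A2 A3 :: "real^2 \<Rightarrow> real" and p
    assume A: "\<forall>p\<in>U. \<forall>s. \<Lambda> p s = A3 p * s^3 + A2 p * s^2 + A1 p * s + A0 p"
      and C5: "Ck_on 5 U A0 \<and> Ck_on 5 U A1 \<and> Ck_on 5 U A2 \<and> Ck_on 5 U A3" and p: "p \<in> U"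
    have eq: "A3 q * s^3 + A2 q * s^2 + A1 q * s + A0 q
        = \<Gamma> 1 2 2 q * s^3 + (2 * \<Gamma> 1 1 2 q - \<Gamma> 2 2 2 q) * s^2
          + (\<Gamma> 1 1 1 q - 2 * \<Gamma> 2 1 2 q) * s + - \<Gamma> 2 1 1 q" if "q \<in> U" for q s
      using A cubic[OF that] that by metis
    show "det (cubic_ode.M A0 A1 A2 A3 p) = 0"
      using C5 cubic_coeffs_unique[OF eq] by (intro det_M_metric[OF assms(1-3) _ _ _ _ _ _ _ _ p]) auto
  qed
qed

end
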